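(* Let $\Sigma$ be a finite alphabet of size $\sigma\ge 2$ (not necessarily constant). There is an algorithm (called $\textsf{Wt}$) which, given an arbitrary pattern $x$ of length $m$ over $\Sigma$ and a text $t$ of length $n>m$ drawn uniformly at random over $\Sigma\cup\{\phi\}$, where $\phi$ is the wildcard, finds all $i$ such that $t[i..i+m-1]$ matches $x$, with average-case search time $O\!\left(\frac{n\log_\sigma m}{m}\right)$, preprocessing time $O\!\left((\sigma+1)^{3\log_{(\sigma+1)/2} m}\, m\log_\sigma m\right)$ and space $O\!\left((\sigma+1)^{3\log_{(\sigma+1)/2} m}\right)$. Moreover this average-case search time is optimal, i.e. no algorithm for this problem (wildcards in the text only) has asymptotically smaller average-case search time.
   Context: The wildcard $\phi\notin\Sigma$ matches itself and every letter of $\Sigma$: two characters $a,b\in\Sigma\cup\{\phi\}$ correspond, $a\approx^{\phi} b$, if they are equal or at least one of them is $\phi$; two strings of equal length match if they correspond at every position. Strings are indexed from $0$. Problem (Wildcards in the Text): given a text $t$ of length $n$ over $\Sigma\cup\{\phi\}$ and a pattern $x$ of length $m$ over $\Sigma$, find all $i$ with $t[i..i+m-1]\approx^{\phi} x[0..m-1]$. Model: word RAM with word size $\Omega(\log n)$. The pattern is arbitrary (not random). The text is random, its characters being independent and uniform over $\Sigma\cup\{\phi\}$. The average-case search time is the expected running time over the random text, for an arbitrary (worst-case) pattern, not counting the time spent preprocessing the pattern. Preprocessing depends only on the pattern and the alphabet.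
   Formalization: Upper bounds are for m ≥ 2 and σ ≤ m^C (any fixed C, constants depending on C), word size ≥ K log(n+σ), since the bound fails if log_σ m → 0 or m = 1; the matching lower bound is for n ≥ (1+ε)m, any ε > 0, as it fails for n = m+1. *)

theory Defs
  imports "HOL-Probability.Probability"
begin

subsection \<open>Strings with wildcards\<close>

text \<open>The alphabet of size \<open>\<sigma>\<close> is \<open>{..<\<sigma>}\<close>; in \<^typ>\<open>nat option\<close>
  the wildcard is \<^const>\<open>None\<close>.\<close>

definition corr :: "nat option \<Rightarrow> nat option \<Rightarrow> bool" where
  "corr a b \<longleftrightarrow> a = b \<or> a = None \<or> b = None"

definition matches :: "nat option list \<Rightarrow> nat option list \<Rightarrow> bool" where
  "matches u v \<longleftrightarrow> list_all2 corr u v"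

definition occurrences :: "nat list \<Rightarrow> nat option list \<Rightarrow> nat set" where
  "occurrences x t =
     {i. i + length x \<le> length t \<and> matches (take (length x) (drop i t)) (map Some x)}"

definition patterns :: "nat \<Rightarrow> nat \<Rightarrow> nat list set" where
  "patterns \<sigma> m = {x. length x = m \<and> set x \<subseteq> {..<\<sigma>}}"

definition text_alphabet :: "nat \<Rightarrow> nat option set" where
  "text_alphabet \<sigma> = insert None (Some ` {..<\<sigma>})"

definition texts :: "nat \<Rightarrow> nat \<Rightarrow> nat option list set" where
  "texts \<sigma> n = {t. length t = n \<and> set t \<subseteq> text_alphabet \<sigma>}"

definition random_text :: "nat \<Rightarrow> nat \<Rightarrow> nat option list pmf" where
  "random_text \<sigma> n = replicate_pmf n (pmf_of_set (text_alphabet \<sigma>))"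


subsection \<open>Word RAM\<close>

text \<open>A word RAM with word size \<open>w\<close>: all register and memory contents are naturals below
  \<open>2 ^ w\<close>, arithmetic is modulo \<open>2 ^ w\<close>.  There is a read-only input, one character per cell;
  the memory, addressed indirectly through registers; and a write-only output.  Programs mention
  finitely many registers.  Control flow is structured rather than by jumps.  Each instruction and
  each test of a branch or loop costs one time unit.\<close>

datatype arith = Add | Sub | Mul | Div | Mod | And | Or | Xor | Shl | Shr

datatype instr =
    Const nat nat          \<comment> \<open>\<open>Const d c\<close>: register \<open>d\<close> gets the constant \<open>c\<close>\<close>
  | Arith arith nat nat nat \<comment> \<open>\<open>Arith f d a b\<close>: register \<open>d\<close> gets \<open>f\<close> of registers \<open>a\<close>, \<open>b\<close>\<close>
  | Load nat nat           \<comment> \<open>\<open>Load d a\<close>: register \<open>d\<close> gets the memory cell addressed by \<open>a\<close>\<close>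
  | Store nat nat          \<comment> \<open>\<open>Store a b\<close>: the memory cell addressed by \<open>a\<close> gets register \<open>b\<close>\<close>
  | Read nat nat           \<comment> \<open>\<open>Read d a\<close>: register \<open>d\<close> gets the input cell addressed by \<open>a\<close>\<close>
  | Output nat

datatype com =
    Instr instr
  | Seq com com
  | IfLess nat nat com com
  | WhileLess nat nat com

text \<open>The field \<open>used\<close> is not accessible to programs; it is the least bound above all memory
  addresses accessed so far.\<close>

record ram =
  reg :: "nat \<Rightarrow> nat"
  mem :: "nat \<Rightarrow> nat"
  out :: "nat list"
  used :: nat

fun arith_op :: "nat \<Rightarrow> arith \<Rightarrow> nat \<Rightarrow> nat \<Rightarrow> nat" where
  "arith_op w Add a b = take_bit w (a + b)"
| "arith_op w Sub a b = take_bit w (a + 2 ^ w - b)"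
| "arith_op w Mul a b = take_bit w (a * b)"
| "arith_op w Div a b = a div b"
| "arith_op w Mod a b = a mod b"
| "arith_op w And a b = Bit_Operations.and a b"
| "arith_op w Or a b = Bit_Operations.or a b"
| "arith_op w Xor a b = Bit_Operations.xor a b"
| "arith_op w Shl a b = take_bit w (push_bit b a)"
| "arith_op w Shr a b = drop_bit b a"

fun step :: "nat \<Rightarrow> nat list \<Rightarrow> instr \<Rightarrow> ram \<Rightarrow> ram" where
  "step w inp (Const d c) s = s\<lparr>reg := (reg s)(d := take_bit w c)\<rparr>"
| "step w inp (Arith f d a b) s = s\<lparr>reg := (reg s)(d := arith_op w f (reg s a) (reg s b))\<rparr>"
| "step w inp (Load d a) s =
     s\<lparr>reg := (reg s)(d := mem s (reg s a)), used := max (used s) (Suc (reg s a))\<rparr>"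
| "step w inp (Store a b) s =
     s\<lparr>mem := (mem s)(reg s a := reg s b), used := max (used s) (Suc (reg s a))\<rparr>"
| "step w inp (Read d a) s =
     s\<lparr>reg := (reg s)(d := if reg s a < length inp then take_bit w (inp ! reg s a) else 0)\<rparr>"
| "step w inp (Output a) s = s\<lparr>out := out s @ [reg s a]\<rparr>"

text \<open>\<open>exec w inp c s k s'\<close>: on word size \<open>w\<close> and input \<open>inp\<close>, program \<open>c\<close> started in \<open>s\<close> halts
  after exactly \<open>k\<close> time units in \<open>s'\<close>.\<close>

inductive exec :: "nat \<Rightarrow> nat list \<Rightarrow> com \<Rightarrow> ram \<Rightarrow> nat \<Rightarrow> ram \<Rightarrow> bool"
  for w :: nat and inp :: "nat list" where
  Instr: "exec w inp (Instr i) s 1 (step w inp i s)"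
| Seq: "\<lbrakk>exec w inp c s k s'; exec w inp d s' l s''\<rbrakk> \<Longrightarrow> exec w inp (Seq c d) s (k + l) s''"
| IfTrue: "\<lbrakk>reg s a < reg s b; exec w inp c s k s'\<rbrakk> \<Longrightarrow> exec w inp (IfLess a b c d) s (Suc k) s'"
| IfFalse: "\<lbrakk>\<not> reg s a < reg s b; exec w inp d s k s'\<rbrakk> \<Longrightarrow> exec w inp (IfLess a b c d) s (Suc k) s'"
| WhileFalse: "\<not> reg s a < reg s b \<Longrightarrow> exec w inp (WhileLess a b c) s 1 s"
| WhileTrue: "\<lbrakk>reg s a < reg s b; exec w inp c s k s'; exec w inp (WhileLess a b c) s' l s''\<rbrakk>
    \<Longrightarrow> exec w inp (WhileLess a b c) s (Suc (k + l)) s''"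

inductive_cases exec_InstrE: "exec w inp (Instr i) s k s'"
inductive_cases exec_SeqE: "exec w inp (Seq c d) s k s'"
inductive_cases exec_IfE: "exec w inp (IfLess a b c d) s k s'"
inductive_cases exec_WhileE: "exec w inp (WhileLess a b c) s k s'"

lemma exec_deterministic:
  "exec w inp c s k s' \<Longrightarrow> exec w inp c s l s'' \<Longrightarrow> k = l \<and> s' = s''"
proof (induction arbitrary: l s'' rule: exec.induct)
  case (Instr i s)
  then show ?case by (auto elim: exec_InstrE)
next
  case (Seq c s k s' d l s'')
  from Seq.prems show ?case by (rule exec_SeqE) (use Seq.IH in blast)
next
  case (IfTrue s a b c k s' d)
  from IfTrue.prems show ?case by (rule exec_IfE) (use IfTrue.hyps IfTrue.IH in blast)+
next
  case (IfFalse s a b d k s' c)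
  from IfFalse.prems show ?case by (rule exec_IfE) (use IfFalse.hyps IfFalse.IH in blast)+
next
  case (WhileFalse s a b c)
  from WhileFalse.prems show ?case by (rule exec_WhileE) (use WhileFalse.hyps in auto)
next
  case (WhileTrue s a b c k s' l s'')
  from WhileTrue.prems show ?case
    by (rule exec_WhileE) (use WhileTrue.hyps WhileTrue.IH in blast)+
qed

definition start :: "nat \<Rightarrow> nat list \<Rightarrow> (nat \<Rightarrow> nat) \<Rightarrow> nat \<Rightarrow> ram" where
  "start w args M u =
     \<lparr>reg = (\<lambda>i. if i < length args then take_bit w (args ! i) else 0),
      mem = M, out = [], used = u\<rparr>"


subsection \<open>Algorithms for matching with wildcards in the text\<close>

text \<open>An algorithm is a preprocessing program together with a search program.  The former gets
  \<open>\<sigma>\<close> and \<open>m\<close> in registers and reads the pattern; it knows neither the text nor \<open>n\<close>.  The latter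
  gets \<open>\<sigma>\<close>, \<open>m\<close> and \<open>n\<close> in registers, reads the text, and inherits the memory left behind by the
  preprocessing.  The wildcard is presented to the machine as \<open>\<sigma>\<close>.\<close>

type_synonym algorithm = "com \<times> com"

definition encode :: "nat \<Rightarrow> nat option \<Rightarrow> nat" where
  "encode \<sigma> a = (case a of None \<Rightarrow> \<sigma> | Some b \<Rightarrow> b)"

definition preprocess_run ::
    "nat \<Rightarrow> algorithm \<Rightarrow> nat \<Rightarrow> nat list \<Rightarrow> nat \<Rightarrow> ram \<Rightarrow> bool" where
  "preprocess_run w A \<sigma> x k s \<longleftrightarrow>
     exec w x (fst A) (start w [\<sigma>, length x] (\<lambda>_. 0) 0) k s"

definition search_run ::
    "nat \<Rightarrow> algorithm \<Rightarrow> nat \<Rightarrow> nat list \<Rightarrow> nat option list \<Rightarrow> nat \<Rightarrow> ram \<Rightarrow> bool" where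
  "search_run w A \<sigma> x t k s \<longleftrightarrow>
     (\<exists>j s0. preprocess_run w A \<sigma> x j s0 \<and>
        exec w (map (encode \<sigma>) t) (snd A)
          (start w [\<sigma>, length x, length t] (mem s0) (used s0)) k s)"

definition solves :: "nat \<Rightarrow> algorithm \<Rightarrow> nat \<Rightarrow> nat \<Rightarrow> nat \<Rightarrow> bool" where
  "solves w A \<sigma> m n \<longleftrightarrow>
     (\<forall>x \<in> patterns \<sigma> m. \<forall>t \<in> texts \<sigma> n.
        \<exists>k s. search_run w A \<sigma> x t k s \<and> set (out s) = occurrences x t)"

text \<open>By determinism of \<^const>\<open>exec\<close> the following are well defined for halting runs.\<close>

definition preprocess_time :: "nat \<Rightarrow> algorithm \<Rightarrow> nat \<Rightarrow> nat list \<Rightarrow> nat" where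
  "preprocess_time w A \<sigma> x = (THE k. \<exists>s. preprocess_run w A \<sigma> x k s)"

definition search_time ::
    "nat \<Rightarrow> algorithm \<Rightarrow> nat \<Rightarrow> nat list \<Rightarrow> nat option list \<Rightarrow> nat" where
  "search_time w A \<sigma> x t = (THE k. \<exists>s. search_run w A \<sigma> x t k s)"

text \<open>Memory of preprocessing and search together, as the search starts from the \<^const>\<open>used\<close>
  of the preprocessing.  Input and output do not count.\<close>

definition space_used :: "nat \<Rightarrow> algorithm \<Rightarrow> nat \<Rightarrow> nat list \<Rightarrow> nat option list \<Rightarrow> nat" where
  "space_used w A \<sigma> x t = (THE u. \<exists>k s. search_run w A \<sigma> x t k s \<and> u = used s)"

text \<open>Expectation over the random text, worst case over the pattern.\<close>

definition average_search_time :: "nat \<Rightarrow> algorithm \<Rightarrow> nat \<Rightarrow> nat \<Rightarrow> nat \<Rightarrow> real" where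
  "average_search_time w A \<sigma> m n =
     (MAX x \<in> patterns \<sigma> m.
        measure_pmf.expectation (random_text \<sigma> n) (\<lambda>t. real (search_time w A \<sigma> x t)))"

end

theory Submission
  imports Defs "HOL-Real_Asymp.Real_Asymp"
begin

text \<open>
  \<^emph>\<open>Upper bound.\<close>  Let \<open>l\<close> be least with \<open>(\<sigma> + 1) ^ l \<ge> m\<^sup>3 2 ^ l\<close> and \<open>M = m\<^sup>3 2 ^ l\<close>.  The
  pattern has at most \<open>m\<close> factors of length \<open>l\<close>, so at most \<open>m 2 ^ l\<close> words over the text alphabet
  match one of them; the preprocessing enumerates these (factor and set of wildcard positions) and
  marks their codes modulo \<open>M\<close> in a table of size \<open>M\<close>.  The search inspects the last \<open>l\<close> characters
  of the windows of length \<open>m\<close> at distance \<open>m - l + 1\<close>.  Every occurrence contains one of these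
  blocks, and a random block hits the table with probability at most
  \<open>m 2 ^ l (1 / M + 1 / (\<sigma> + 1) ^ l) \<le> 2 / m\<^sup>2\<close>, which pays for the naive verification of the window
  in time \<open>O(m\<^sup>2)\<close>.  Reducing the codes modulo \<open>M\<close> is what avoids a factor \<open>\<sigma>\<close> in the space, lost
  otherwise when \<open>l\<close> is rounded up.  If \<open>m < 2 l\<close> then \<open>m\<close> is bounded and one searches naively.

  \<^emph>\<open>Lower bound.\<close>  For a random pattern, any \<open>k = \<lfloor>log\<^sub>\<sigma> m / 4\<rfloor>\<close> characters at any
  positions of a text block of length \<open>(1 + \<epsilon>) m\<close> are, with positive probability, all consistent with
  an occurrence somewhere in the block.  Fix such a pattern.  Whatever the text, a correct search
  must then read more than \<open>k\<close> characters in each of the disjoint blocks: otherwise the unread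
  characters can be changed so that there is an occurrence, and also so that there is none.
\<close>

subsection \<open>Runs of programs\<close>

text \<open>Time bounds the number of inspected cells: only \<open>Read\<close> looks at the input,
  and each \<open>Read\<close> costs one unit. A read beyond the end yields \<open>0\<close> and
  depends on nothing but the length, so \<open>R\<close> can be kept within range as long as the
  length is preserved.\<close>

lemma exec_reads_few:
  assumes "exec w inp c s k s'"
  shows "\<exists>R. R \<subseteq> {..<length inp} \<and> card R \<le> k \<and>
    (\<forall>inp'. length inp' = length inp \<longrightarrow> (\<forall>i\<in>R. inp' ! i = inp ! i) \<longrightarrow> exec w inp' c s k s')"
  using assms
proof (induction rule: exec.induct)
  case (Instr i s)
  show ?case
  proof (cases "\<exists>d a. i = Read d a \<and> reg s a < length inp")
    case True
    then obtain d a where i: "i = Read d a" "reg s a < length inp" by blast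
    have "exec w inp' (Instr i) s 1 (step w inp i s)"
      if "length inp' = length inp" "\<forall>j\<in>{reg s a}. inp' ! j = inp ! j" for inp'
      using exec.Instr[of w inp' i s] that i by simp
    then show ?thesis using i by (intro exI[of _ "{reg s a}"]) auto
  next
    case False
    have "exec w inp' (Instr i) s 1 (step w inp i s)" if "length inp' = length inp" for inp'
      using exec.Instr[of w inp' i s] that False by (cases i) auto
    then show ?thesis by (intro exI[of _ "{}"]) auto
  qed
next
  case (Seq c s k s' d l s'')
  then obtain R1 R2 where
    "R1 \<subseteq> {..<length inp}" "card R1 \<le> k"
    "\<And>inp'. length inp' = length inp \<Longrightarrow> (\<forall>i\<in>R1. inp' ! i = inp ! i) \<Longrightarrow> exec w inp' c s k s'"
    "R2 \<subseteq> {..<length inp}" "card R2 \<le> l"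
    "\<And>inp'. length inp' = length inp \<Longrightarrow> (\<forall>i\<in>R2. inp' ! i = inp ! i) \<Longrightarrow> exec w inp' d s' l s''"
    by metis
  then show ?case
    by (intro exI[of _ "R1 \<union> R2"]) (auto intro!: exec.Seq[where s' = s'] order.trans[OF card_Un_le])
next
  case (IfTrue s a b c k s' d)
  then obtain R where "R \<subseteq> {..<length inp}" "card R \<le> k"
    "\<And>inp'. length inp' = length inp \<Longrightarrow> (\<forall>i\<in>R. inp' ! i = inp ! i) \<Longrightarrow> exec w inp' c s k s'"
    by blast
  with IfTrue.hyps show ?case by (intro exI[of _ R]) (auto intro!: exec.IfTrue)
next
  case (IfFalse s a b d k s' c)
  then obtain R where "R \<subseteq> {..<length inp}" "card R \<le> k"
    "\<And>inp'. length inp' = length inp \<Longrightarrow> (\<forall>i\<in>R. inp' ! i = inp ! i) \<Longrightarrow> exec w inp' d s k s'"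
    by blast
  with IfFalse.hyps show ?case by (intro exI[of _ R]) (auto intro!: exec.IfFalse)
next
  case (WhileFalse s a b c)
  then show ?case by (intro exI[of _ "{}"]) (simp add: exec.WhileFalse[unfolded One_nat_def])
next
  case (WhileTrue s a b c k s' l s'')
  then obtain R1 R2 where
    "R1 \<subseteq> {..<length inp}" "card R1 \<le> k"
    "\<And>inp'. length inp' = length inp \<Longrightarrow> (\<forall>i\<in>R1. inp' ! i = inp ! i) \<Longrightarrow> exec w inp' c s k s'"
    "R2 \<subseteq> {..<length inp}" "card R2 \<le> l"
    "\<And>inp'. length inp' = length inp \<Longrightarrow> (\<forall>i\<in>R2. inp' ! i = inp ! i) \<Longrightarrow>
        exec w inp' (WhileLess a b c) s' l s''"
    by metis
  with WhileTrue.hyps show ?case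
    by (intro exI[of _ "R1 \<union> R2"]) (auto intro!: exec.WhileTrue[where s' = s'] le_SucI order.trans[OF card_Un_le])
qed

section \<open>Time and space of halting runs\<close>

lemma search_run_deterministic:
  assumes "search_run w A \<sigma> x t k s" "search_run w A \<sigma> x t k' s'"
  shows "k = k' \<and> s = s'"
proof -
  from assms obtain j s0 j' s0' where
    "preprocess_run w A \<sigma> x j s0" "preprocess_run w A \<sigma> x j' s0'"
    and e: "exec w (map (encode \<sigma>) t) (snd A) (start w [\<sigma>, length x, length t] (mem s0) (used s0)) k s"
    "exec w (map (encode \<sigma>) t) (snd A) (start w [\<sigma>, length x, length t] (mem s0') (used s0')) k' s'"
    unfolding search_run_def by blast
  then have "s0 = s0'" unfolding preprocess_run_def using exec_deterministic by blast
  with e show ?thesis using exec_deterministic by blast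
qed

lemma search_time_eq: "search_run w A \<sigma> x t k s \<Longrightarrow> search_time w A \<sigma> x t = k"
  unfolding search_time_def by (rule the_equality) (auto dest: search_run_deterministic)

lemma space_used_eq: "search_run w A \<sigma> x t k s \<Longrightarrow> space_used w A \<sigma> x t = used s"
  unfolding space_used_def by (rule the_equality) (auto dest: search_run_deterministic)

lemma preprocess_time_eq: "preprocess_run w A \<sigma> x k s \<Longrightarrow> preprocess_time w A \<sigma> x = k"
  unfolding preprocess_time_def preprocess_run_def
  by (rule the_equality) (auto dest: exec_deterministic)

lemma mem_occurrences_iff:
  "i \<in> occurrences x t \<longleftrightarrow> i + length x \<le> length t \<and>
     (\<forall>j<length x. t ! (i + j) = None \<or> t ! (i + j) = Some (x ! j))"
proof (cases "i + length x \<le> length t")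
  case True
  then have "min (length x) (length t - i) = length x" by auto
  moreover from True have "j < length t - i" if "j < length x" for j using that by simp
  ultimately show ?thesis
    using True by (auto simp: occurrences_def matches_def list_all2_conv_all_nth corr_def)
qed (simp add: occurrences_def)

text \<open>The preprocessing never sees the text, so its final state \<open>s0\<close> is common to
  all texts, and \<open>R\<close> consists of the reads of the search program alone.\<close>

lemma search_run_reads_few:
  assumes "search_run w A \<sigma> x t k s"
  shows "\<exists>R. R \<subseteq> {..<length t} \<and> card R \<le> k \<and>
    (\<forall>t'. length t' = length t \<longrightarrow> (\<forall>i\<in>R. t' ! i = t ! i) \<longrightarrow> search_run w A \<sigma> x t' k s)"
proof -
  from assms obtain j s0 where pre: "preprocess_run w A \<sigma> x j s0"
    and e: "exec w (map (encode \<sigma>) t) (snd A) (start w [\<sigma>, length x, length t] (mem s0) (used s0)) k s"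
    unfolding search_run_def by blast
  from exec_reads_few[OF e] obtain R where R: "R \<subseteq> {..<length t}" "card R \<le> k"
    and *: "\<And>inp'. length inp' = length t \<Longrightarrow> (\<forall>i\<in>R. inp' ! i = map (encode \<sigma>) t ! i) \<Longrightarrow>
      exec w inp' (snd A) (start w [\<sigma>, length x, length t] (mem s0) (used s0)) k s"
    by auto
  have "search_run w A \<sigma> x t' k s" if "length t' = length t" "\<forall>i\<in>R. t' ! i = t ! i" for t'
    using *[of "map (encode \<sigma>) t'"] that R(1) pre
    unfolding search_run_def by (auto simp: subset_iff)
  with R show ?thesis by blast
qed

section \<open>Finite spaces of patterns and texts\<close>

lemma finite_patterns [simp]: "finite (patterns \<sigma> m)"
proof -
  have "patterns \<sigma> m = {x. set x \<subseteq> {..<\<sigma>} \<and> length x = m}" by (auto simp: patterns_def)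
  then show ?thesis by (simp add: finite_lists_length_eq)
qed

lemma finite_texts [simp]: "finite (texts \<sigma> n)"
proof -
  have "texts \<sigma> n = {x. set x \<subseteq> text_alphabet \<sigma> \<and> length x = n}" by (auto simp: texts_def)
  then show ?thesis by (simp add: finite_lists_length_eq text_alphabet_def)
qed

lemma map_upt_mem_texts: "map f [0..<n] \<in> texts \<sigma> n \<longleftrightarrow> (\<forall>i<n. f i \<in> text_alphabet \<sigma>)"
  by (auto simp: texts_def)

lemma set_pmf_random_text: "set_pmf (random_text \<sigma> n) = texts \<sigma> n"
proof -
  have "set_pmf (pmf_of_set (text_alphabet \<sigma>)) = text_alphabet \<sigma>"
    by (subst set_pmf_of_set) (auto simp: text_alphabet_def)
  then show ?thesis by (auto simp: random_text_def texts_def set_replicate_pmf lists_eq_set)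
qed

lemma integrable_random_text [simp]: "integrable (measure_pmf (random_text \<sigma> n)) (f :: _ \<Rightarrow> real)"
  by (rule integrable_measure_pmf_finite) (simp add: set_pmf_random_text)

subsection \<open>Patterns that force many reads\<close>

text \<open>\<open>P\<close> stands for the positions read in a text block of length
  \<open>length x + h\<close>, \<open>v\<close> for the letters seen there, and \<open>s\<close> for
  a placement of the pattern that they do not exclude. Positions of \<open>P\<close> outside the
  window at \<open>s\<close> impose nothing.\<close>

definition robust :: "nat \<Rightarrow> nat \<Rightarrow> nat \<Rightarrow> nat list \<Rightarrow> bool" where
  "robust \<sigma> h k x \<longleftrightarrow> (\<forall>P v. P \<subseteq> {..<length x + h} \<longrightarrow> card P < k \<longrightarrow> v ` P \<subseteq> {..<\<sigma>} \<longrightarrow>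
     (\<exists>s\<le>h. \<forall>p\<in>P. s \<le> p \<longrightarrow> p < s + length x \<longrightarrow> x ! (p - s) = v p))"

text \<open>The trivial bound of one read per block, which serves small patterns and very large
  alphabets.\<close>

lemma robust_1: "robust \<sigma> h 1 x"
proof -
  have "P = {}" if "P \<subseteq> {..<length x + h}" "card P < 1" for P
    using that finite_subset[OF that(1)] by simp
  then show ?thesis unfolding robust_def by (metis empty_iff le0)
qed

text \<open>Adversary argument: a fast run leaves some block with fewer than \<open>k\<close> reads.
  Two texts that agree with \<open>t\<close> on all reads produce the same output, yet one has an
  occurrence in that block at a place where the other has none.\<close>

lemma robust_search_time:
  assumes "solves w A \<sigma> m n" "x \<in> patterns \<sigma> m" "t \<in> texts \<sigma> n" "2 \<le> \<sigma>"
    and rob: "robust \<sigma> h k x" and "k \<le> m" "1 \<le> m"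
  shows "k * (n div (m + h)) \<le> search_time w A \<sigma> x t"
proof (rule ccontr)
  assume less: "\<not> ?thesis"
  have sol: "\<exists>k s. search_run w A \<sigma> x u k s \<and> set (out s) = occurrences x u" if "u \<in> texts \<sigma> n" for u
    using assms(1,2) that by (auto simp: solves_def)
  from sol[OF assms(3)] obtain K s where run: "search_run w A \<sigma> x t K s" by blast
  have K: "search_time w A \<sigma> x t = K" using run by (rule search_time_eq)
  from search_run_reads_few[OF run] obtain R where R: "R \<subseteq> {..<length t}" "card R \<le> K"
    and same: "\<And>t'. length t' = length t \<Longrightarrow> (\<forall>i\<in>R. t' ! i = t ! i) \<Longrightarrow> search_run w A \<sigma> x t' K s"
    by blast
  have lx: "length x = m" and lt: "length t = n" and sx: "\<And>j. j < m \<Longrightarrow> x ! j < \<sigma>"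
    and st: "\<And>j. j < n \<Longrightarrow> t ! j \<in> text_alphabet \<sigma>"
    using assms(2,3) by (auto simp: patterns_def texts_def subset_iff)
  have finR: "finite R" using R(1) by (rule finite_subset) simp
  define N where "N = n div (m + h)"
  define B where "B j = {p \<in> R. p div (m + h) = j}" for j
  \<comment> \<open>Pigeonhole over the \<open>N\<close> disjoint blocks of length
    \<open>m + h\<close>.\<close>
  have "\<exists>j<N. card (B j) < k"
  proof (rule ccontr)
    assume "\<not> (\<exists>j<N. card (B j) < k)"
    then have ge: "k \<le> card (B j)" if "j < N" for j using that by auto
    have "k * N \<le> (\<Sum>j<N. card (B j))"
      using sum_bounded_below[of "{..<N}" k "\<lambda>j. card (B j)"] ge by (simp add: mult.commute)
    also have "\<dots> = card (\<Union>j<N. B j)"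
      by (rule card_UN_disjoint[symmetric]) (auto simp: B_def finR)
    also have "\<dots> \<le> card R" by (rule card_mono) (auto simp: B_def finR)
    finally show False using less R(2) K by (simp add: N_def)
  qed
  then obtain j where j: "j < N" "card (B j) < k" by blast
  define b where "b = j * (m + h)"
  have bn: "b + (m + h) \<le> n"
  proof -
    have "Suc j * (m + h) \<le> N * (m + h)" using j(1) by (intro mult_right_mono) auto
    also have "\<dots> \<le> n" by (simp add: N_def)
    finally show ?thesis by (simp add: b_def)
  qed
  define P where "P = {p. p < m + h \<and> b + p \<in> R}"
  have inB: "b + p \<in> B j \<longleftrightarrow> b + p \<in> R" if "p < m + h" for p
  proof -
    have "(j * (m + h) + p) div (m + h) = j"
      by (metis add.right_neutral div_less div_mult_self3 less_nat_zero_code that)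
    then show ?thesis by (simp add: B_def b_def)
  qed
  have "card P = card ((+) b ` P)" by (rule card_image[symmetric]) simp
  also have "\<dots> \<le> card (B j)"
    by (rule card_mono) (auto simp: P_def inB, simp add: B_def finR)
  finally have cP: "card P < k" using j(2) by simp
  \<comment> \<open>A wildcard that was read is consistent with every letter, so replacing it by the
    letter \<open>0\<close> only asks for more than is necessary.\<close>
  define v where "v p = (case t ! (b + p) of None \<Rightarrow> 0 | Some a \<Rightarrow> a)" for p
  have "v ` P \<subseteq> {..<\<sigma>}"
  proof
    fix y assume "y \<in> v ` P"
    then obtain p where p: "p < m + h" "y = v p" by (auto simp: P_def)
    have "t ! (b + p) \<in> text_alphabet \<sigma>" using p bn by (intro st) auto
    then show "y \<in> {..<\<sigma>}" using p \<open>2 \<le> \<sigma>\<close> by (auto simp: v_def text_alphabet_def)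
  qed
  with rob cP obtain q where q: "q \<le> h"
    and agree: "\<And>p. p \<in> P \<Longrightarrow> q \<le> p \<Longrightarrow> p < q + m \<Longrightarrow> x ! (p - q) = v p"
    unfolding robust_def lx by (metis (no_types, lifting) P_def lessThan_iff mem_Collect_eq subsetI)
  define W where "W = {b + q..<b + q + m}"
  \<comment> \<open>Fewer than \<open>k \<le> m\<close> reads cannot fill a window of length
    \<open>m\<close>, so there is an unread position at which to spoil the occurrence.\<close>
  have "\<exists>u\<in>W. u \<notin> R"
  proof (rule ccontr)
    assume "\<not> (\<exists>u\<in>W. u \<notin> R)"
    then have "{q..<q+m} \<subseteq> P" using q by (auto simp: P_def W_def)
    moreover have "finite P" by (simp add: P_def)
    ultimately have "m \<le> card P" by (metis card_atLeastLessThan card_mono diff_add_inverse)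
    then show False using cP \<open>k \<le> m\<close> by simp
  qed
  then obtain u where u: "u \<in> W" "u \<notin> R" by blast
  \<comment> \<open>A letter different from the one the pattern has at \<open>u\<close>; two letters
    exist since \<open>2 \<le> \<sigma>\<close>.\<close>
  define e where "e = (if x ! (u - (b + q)) = 0 then 1 else 0 :: nat)"
  \<comment> \<open>\<open>t1\<close> completes the window to an occurrence, \<open>t2\<close> puts
    a mismatch at \<open>u\<close>; neither touches a position that was read.\<close>
  define t1 where "t1 = map (\<lambda>i. if i \<in> W \<and> i \<notin> R then Some (x ! (i - (b + q))) else t ! i) [0..<n]"
  define t2 where "t2 = map (\<lambda>i. if i = u then Some e else t ! i) [0..<n]"
  have t1: "t1 \<in> texts \<sigma> n"
    unfolding t1_def map_upt_mem_texts
  proof (intro allI impI)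
    fix i assume "i < n"
    moreover have "Some (x ! (i - (b + q))) \<in> text_alphabet \<sigma>" if "i \<in> W"
      using that sx[of "i - (b + q)"] by (simp add: W_def text_alphabet_def less_diff_conv2)
    ultimately show "(if i \<in> W \<and> i \<notin> R then Some (x ! (i - (b + q))) else t ! i) \<in> text_alphabet \<sigma>"
      using st by simp
  qed
  have t2: "t2 \<in> texts \<sigma> n"
    unfolding t2_def map_upt_mem_texts
    using st \<open>2 \<le> \<sigma>\<close> by (simp add: text_alphabet_def e_def)
  have Rn: "i < n" if "i \<in> R" for i using that R(1) lt by auto
  have "search_run w A \<sigma> x t1 K s" by (rule same) (auto simp: t1_def lt Rn)
  moreover have "search_run w A \<sigma> x t2 K s" by (rule same) (use u in \<open>auto simp: t2_def lt Rn\<close>)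
  ultimately have eq: "occurrences x t1 = occurrences x t2"
    using sol[OF t1] sol[OF t2] search_run_deterministic by metis
  have "b + q \<in> occurrences x t1"
    unfolding mem_occurrences_iff lx
  proof (intro conjI allI impI)
    show "b + q + m \<le> length t1" using bn q by (simp add: t1_def)
    fix i assume i: "i < m"
    then have "b + q + i < n" using bn q by simp
    moreover have "t ! (b + q + i) = None \<or> t ! (b + q + i) = Some (x ! i)" if "b + q + i \<in> R"
    proof -
      have "q + i \<in> P" using that i q by (simp add: P_def add.assoc)
      from agree[OF this] i have "x ! i = v (q + i)" by simp
      then show ?thesis by (auto simp: v_def add.assoc split: option.splits)
    qed
    ultimately show "t1 ! (b + q + i) = None \<or> t1 ! (b + q + i) = Some (x ! i)"
      using i by (auto simp: t1_def W_def)
  qed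
  moreover have "b + q \<notin> occurrences x t2"
  proof
    assume a: "b + q \<in> occurrences x t2"
    have "u - (b + q) < m" "b + q + (u - (b + q)) = u" using u by (auto simp: W_def)
    with a have "t2 ! u = None \<or> t2 ! u = Some (x ! (u - (b + q)))"
      unfolding mem_occurrences_iff lx by metis
    moreover have "u < n" using u bn q by (auto simp: W_def)
    ultimately show False by (auto simp: t2_def e_def split: if_splits)
  qed
  ultimately show False using eq by simp
qed

text \<open>Take a maximal \<open>S\<close> whose translates of \<open>P\<close> are pairwise
  disjoint. By maximality every shift up to \<open>h\<close> has the form \<open>s + p' - p\<close>
  with \<open>s\<close> in \<open>S\<close>, and there are at most
  \<open>card S * card P ^ 2\<close> such numbers. The equation \<open>p + s' = p' + s\<close>
  expresses \<open>p - s = p' - s'\<close> without truncated subtraction.\<close>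

lemma spread_shifts:
  fixes P :: "nat set"
  assumes "finite P" "P \<noteq> {}"
  obtains S where "S \<subseteq> {..h}" "Suc h \<le> card S * card P ^ 2"
    "\<And>s s' p p'. s \<in> S \<Longrightarrow> s' \<in> S \<Longrightarrow> p \<in> P \<Longrightarrow> p' \<in> P \<Longrightarrow> p + s' = p' + s \<Longrightarrow> s = s'"
proof -
  define good where "good S \<longleftrightarrow> S \<subseteq> {..h} \<and>
    (\<forall>s\<in>S. \<forall>s'\<in>S. \<forall>p\<in>P. \<forall>p'\<in>P. p + s' = p' + s \<longrightarrow> s = s')" for S
  have "finite {S. good S}" by (rule finite_subset[of _ "Pow {..h}"]) (auto simp: good_def)
  moreover have "good {}" by (simp add: good_def)
  ultimately obtain S where S: "good S" and max: "\<And>S'. good S' \<Longrightarrow> S \<subseteq> S' \<Longrightarrow> S' = S"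
    using finite_has_maximal2[of "{S. good S}" "{}"] by auto
  have finS: "finite S" using S by (auto simp: good_def intro: finite_subset)
  have "{..h} \<subseteq> (\<Union>s\<in>S. (\<lambda>(p, p'). s + p' - p) ` (P \<times> P))"
  proof
    fix u assume u: "u \<in> {..h}"
    show "u \<in> (\<Union>s\<in>S. (\<lambda>(p, p'). s + p' - p) ` (P \<times> P))"
    proof (cases "u \<in> S")
      case True
      obtain p where "p \<in> P" using assms by blast
      with True show ?thesis by (intro UN_I[of u] image_eqI[of _ _ "(p, p)"]) auto
    next
      case False
      then have "\<not> good (insert u S)" using max by blast
      then obtain s p p' where "s \<in> S" "p \<in> P" "p' \<in> P" "p + u = p' + s"
        using S u unfolding good_def by (metis (no_types, lifting) insert_iff insert_subset)
      then show ?thesis by (intro UN_I[of s] image_eqI[of _ _ "(p, p')"]) auto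
    qed
  qed
  then have "card {..h} \<le> card (\<Union>s\<in>S. (\<lambda>(p, p'). s + p' - p) ` (P \<times> P))"
    by (rule card_mono[rotated]) (use finS assms in auto)
  also have "\<dots> \<le> (\<Sum>s\<in>S. card ((\<lambda>(p, p'). s + p' - p) ` (P \<times> P)))"
    by (rule card_UN_le[OF finS])
  also have "\<dots> \<le> (\<Sum>s\<in>S. card (P \<times> P))"
    by (intro sum_mono card_image_le) (use assms in auto)
  also have "\<dots> = card S * card P ^ 2" by (simp add: card_cartesian_product power2_eq_square)
  finally have "Suc h \<le> card S * card P ^ 2" by simp
  then show ?thesis using S that[of S] unfolding good_def by blast
qed

text \<open>Independence in counting form: to agree with \<open>c s\<close> on \<open>Q s\<close>
  has probability at least \<open>1 / card A ^ k\<close>, and for different \<open>s\<close> these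
  events concern disjoint coordinates. The induction adds one event at a time.\<close>

lemma card_avoiding_functions:
  fixes I :: "'a set" and A :: "'b set"
  assumes "finite I" "finite A" "A \<noteq> {}" "finite S"
    and Q: "\<And>s. s \<in> S \<Longrightarrow> Q s \<subseteq> I \<and> card (Q s) \<le> k \<and> c s ` Q s \<subseteq> A"
    and disj: "disjoint_family_on Q S"
  shows "real (card {x \<in> I \<rightarrow>\<^sub>E A. \<forall>s\<in>S. \<exists>q\<in>Q s. x q \<noteq> c s q})
           \<le> real (card A) ^ card I * (1 - 1 / real (card A) ^ k) ^ card S"
  using assms(4) Q disj
proof (induction S rule: finite_induct)
  case empty
  show ?case using assms by (simp add: card_PiE)
next
  case (insert u S)
  define F where "F = {x \<in> I \<rightarrow>\<^sub>E A. \<forall>s\<in>S. \<exists>q\<in>Q s. x q \<noteq> c s q}"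
  define G where "G = {x \<in> F. \<forall>q\<in>Q u. x q = c u q}"
  have IH: "real (card F) \<le> real (card A) ^ card I * (1 - 1 / real (card A) ^ k) ^ card S"
    unfolding F_def by (rule insert.IH) (use insert.prems in \<open>auto simp: disjoint_family_on_def\<close>)
  have A1: "1 \<le> card A" using assms by (simp add: Suc_le_eq card_gt_0_iff)
  have finF: "finite F" unfolding F_def
    by (rule finite_subset[of _ "I \<rightarrow>\<^sub>E A"]) (use assms in \<open>auto intro: finite_PiE\<close>)
  have finG: "finite G" using finF by (simp add: G_def)
  have u: "Q u \<subseteq> I" "card (Q u) \<le> k" "c u ` Q u \<subseteq> A" using insert.prems by auto
  have finQ: "finite (Q u)" using u(1) assms(1) by (rule finite_subset)
  \<comment> \<open>Overwriting \<open>x\<close> by \<open>c u\<close> on \<open>Q u\<close> leads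
    from \<open>F\<close> into \<open>G\<close>, because the other \<open>Q s\<close> are disjoint
    from \<open>Q u\<close> and remain untouched. The overwritten values are kept as second
    component, so at most \<open>card A ^ k\<close> functions share an image in
    \<open>G\<close>.\<close>
  define f where "f x = ((\<lambda>i. if i \<in> Q u then c u i else x i), restrict x (Q u))" for x
  have inj: "inj_on f F"
  proof (rule inj_onI)
    fix x y assume "f x = f y"
    then have 1: "(if i \<in> Q u then c u i else x i) = (if i \<in> Q u then c u i else y i)"
      and 2: "restrict x (Q u) i = restrict y (Q u) i" for i
      by (auto simp: f_def fun_eq_iff)
    show "x = y"
    proof
      fix i show "x i = y i" using 1[of i] 2[of i] by (cases "i \<in> Q u") auto
    qed
  qed
  have "f ` F \<subseteq> G \<times> (Q u \<rightarrow>\<^sub>E A)"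
  proof
    fix y assume "y \<in> f ` F"
    then obtain x where x: "x \<in> F" "y = f x" by blast
    have "\<exists>q\<in>Q s. (if q \<in> Q u then c u q else x q) \<noteq> c s q" if "s \<in> S" for s
    proof -
      from x(1) that have "\<exists>q\<in>Q s. x q \<noteq> c s q" by (simp add: F_def)
      then obtain q where "q \<in> Q s" "x q \<noteq> c s q" by blast
      moreover have "q \<notin> Q u"
        using insert.prems(2) \<open>q \<in> Q s\<close> that insert.hyps by (auto simp: disjoint_family_on_def)
      ultimately show ?thesis by (intro bexI[of _ q]) auto
    qed
    then show "y \<in> G \<times> (Q u \<rightarrow>\<^sub>E A)"
      using x u by (auto simp: f_def G_def F_def PiE_iff extensional_def)
  qed
  then have "card F \<le> card (G \<times> (Q u \<rightarrow>\<^sub>E A))"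
    by (rule card_inj_on_le[OF inj]) (use finG finQ assms in \<open>auto intro: finite_PiE\<close>)
  also have "\<dots> = card G * card A ^ card (Q u)"
    by (simp add: card_cartesian_product card_PiE finQ)
  also have "\<dots> \<le> card G * card A ^ k" by (intro mult_left_mono power_increasing u A1) auto
  finally have FG: "real (card F) \<le> real (card G) * real (card A) ^ k"
    by (metis of_nat_le_iff of_nat_mult of_nat_power)
  have Apos: "0 < real (card A) ^ k" using A1 by simp
  have "{x \<in> I \<rightarrow>\<^sub>E A. \<forall>s\<in>insert u S. \<exists>q\<in>Q s. x q \<noteq> c s q} = F - G"
    by (auto simp: F_def G_def)
  moreover have "real (card (F - G)) = real (card F) - real (card G)"
    by (subst card_Diff_subset) (auto simp: finG G_def intro!: of_nat_diff card_mono finF)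
  moreover have "\<dots> \<le> real (card F) * (1 - 1 / real (card A) ^ k)"
    using FG Apos by (simp add: field_simps)
  moreover have "\<dots> \<le> real (card A) ^ card I * (1 - 1 / real (card A) ^ k) ^ card S
      * (1 - 1 / real (card A) ^ k)"
    by (rule mult_right_mono[OF IH]) (use A1 in simp)
  ultimately show ?case using insert.hyps by (simp add: mult_ac)
qed

text \<open>The probabilistic method: a random pattern fails for fixed \<open>P\<close> and \<open>v\<close> with probability at
  most \<open>(1 - \<sigma>\<^sup>-\<^sup>k) ^ |S|\<close> with \<open>S\<close> from \<open>spread_shifts\<close>.\<close>
lemma robust_exists:
  assumes \<sigma>: "1 \<le> \<sigma>" and "1 \<le> k" and r: "r * k ^ 2 \<le> Suc h"
    and small: "(real (m + h) * real \<sigma>) ^ k * (1 - 1 / real \<sigma> ^ k) ^ r < 1"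
  shows "\<exists>x\<in>patterns \<sigma> m. robust \<sigma> h (Suc k) x"
proof (rule ccontr)
  assume none: "\<not> ?thesis"
  \<comment> \<open>Lists of exactly \<open>k\<close> pairs of position and letter stand for all
    \<open>P\<close> and \<open>v\<close> with at most \<open>k\<close> positions; their number has
    the simple form \<open>((m + h) * \<sigma>) ^ k\<close>.\<close>
  define J where "J = {l. set l \<subseteq> {..<m + h} \<times> {..<\<sigma>} \<and> length l = k}"
  define bad where "bad l = {x \<in> {..<m} \<rightarrow>\<^sub>E {..<\<sigma>}. \<forall>s\<le>h. \<exists>p\<in>fst ` set l. s \<le> p \<and> p < s + m \<and>
      x (p - s) \<noteq> the (map_of l p)}" for l
  have finPiE: "finite ({..<m} \<rightarrow>\<^sub>E {..<\<sigma>})" by (intro finite_PiE) auto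
  have finJ: "finite J" unfolding J_def by (rule finite_lists_length_eq) simp
  have cover: "{..<m} \<rightarrow>\<^sub>E {..<\<sigma>} \<subseteq> (\<Union>l\<in>J. bad l)"
  proof
    fix x assume x: "x \<in> {..<m} \<rightarrow>\<^sub>E {..<\<sigma>}"
    define y where "y = map x [0..<m]"
    have "y \<in> patterns \<sigma> m" using PiE_mem[OF x] by (simp add: y_def patterns_def image_subset_iff)
    with none have "\<not> robust \<sigma> h (Suc k) y" by blast
    moreover have "length y = m" by (simp add: y_def)
    ultimately obtain P v where P: "P \<subseteq> {..<m + h}" "card P \<le> k" "v ` P \<subseteq> {..<\<sigma>}"
      and fail: "\<And>s. s \<le> h \<Longrightarrow> \<exists>p\<in>P. s \<le> p \<and> p < s + m \<and> y ! (p - s) \<noteq> v p"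
      unfolding robust_def less_Suc_eq_le by metis
    have finP: "finite P" using P(1) by (rule finite_subset) simp
    obtain xs where xs: "set xs = P" "distinct xs" using finite_distinct_list[OF finP] by blast
    have "P \<noteq> {}" using fail[of 0] by auto
    then have "xs \<noteq> []" using xs by auto
    \<comment> \<open>Repeating the first position brings the list to length \<open>k\<close>
      without changing its set; repeated entries carry the same letter.\<close>
    define ps where "ps = xs @ replicate (k - length xs) (hd xs)"
    have ps: "set ps = P" "length ps = k"
      using xs \<open>xs \<noteq> []\<close> P(2) by (auto simp: ps_def distinct_card[symmetric])
    define l where "l = map (\<lambda>p. (p, v p)) ps"
    have l: "map_of l p = Some (v p)" if "p \<in> P" for p
      using that ps(1) by (simp add: l_def map_of_map_restrict)
    have fl: "fst ` set l = P" using ps(1) by (force simp: l_def)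
    have "l \<in> J" using ps P by (auto simp: J_def l_def)
    moreover have "x \<in> bad l"
      unfolding bad_def mem_Collect_eq fl
    proof (intro conjI allI impI)
      fix s assume "s \<le> h"
      from fail[OF this] obtain p where p: "p \<in> P" "s \<le> p" "p < s + m" "y ! (p - s) \<noteq> v p" by blast
      moreover have "y ! (p - s) = x (p - s)" using p by (simp add: y_def)
      ultimately show "\<exists>p\<in>P. s \<le> p \<and> p < s + m \<and> x (p - s) \<noteq> the (map_of l p)"
        using l by (intro bexI[of _ p]) auto
    qed (fact x)
    ultimately show "x \<in> (\<Union>l\<in>J. bad l)" by blast
  qed
  define y where "y = 1 - 1 / real \<sigma> ^ k"
  have y: "0 \<le> y" "y \<le> 1" using \<sigma> by (auto simp: y_def)
  have card_bad: "real (card (bad l)) \<le> real \<sigma> ^ m * y ^ r" if "l \<in> J" for l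
  proof -
    define P where "P = fst ` set l"
    have P: "finite P" "P \<noteq> {}" "card P \<le> k"
      using that \<open>1 \<le> k\<close> card_length[of l] card_image_le[of "set l" fst] by (auto simp: P_def J_def)
    have val: "the (map_of l p) < \<sigma>" if "p \<in> P" for p
    proof -
      from that have "map_of l p \<noteq> None" by (simp add: P_def map_of_eq_None_iff)
      then obtain z where "map_of l p = Some z" by blast
      with map_of_SomeD[OF this] \<open>l \<in> J\<close> show ?thesis by (auto simp: J_def)
    qed
    obtain S where S: "S \<subseteq> {..h}" "Suc h \<le> card S * card P ^ 2"
      "\<And>s s' p p'. s \<in> S \<Longrightarrow> s' \<in> S \<Longrightarrow> p \<in> P \<Longrightarrow> p' \<in> P \<Longrightarrow> p + s' = p' + s \<Longrightarrow> s = s'"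
      using spread_shifts[OF P(1,2)] by metis
    have "r * k ^ 2 \<le> card S * k ^ 2"
      using r S(2) power_mono[OF P(3), of 2] by (meson le_trans mult_le_mono2 zero_le)
    then have rS: "r \<le> card S" using \<open>1 \<le> k\<close> by simp
    \<comment> \<open>The pattern positions that fall on \<open>P\<close> when the pattern is placed
      at \<open>s\<close>, and the letters demanded there. Only shifts in \<open>S\<close> are kept,
      since for these the sets \<open>Q s\<close> are disjoint.\<close>
    define Q where "Q s = (\<lambda>p. p - s) ` {p\<in>P. s \<le> p \<and> p < s + m}" for s
    define c where "c s q = the (map_of l (q + s))" for s q
    have finS: "finite S" using S(1) by (rule finite_subset) simp
    have "bad l \<subseteq> {x \<in> {..<m} \<rightarrow>\<^sub>E {..<\<sigma>}. \<forall>s\<in>S. \<exists>q\<in>Q s. x q \<noteq> c s q}"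
      using S(1) by (force simp: bad_def Q_def c_def P_def[symmetric])
    then have "card (bad l) \<le> card {x \<in> {..<m} \<rightarrow>\<^sub>E {..<\<sigma>}. \<forall>s\<in>S. \<exists>q\<in>Q s. x q \<noteq> c s q}"
      by (rule card_mono[rotated]) (use finPiE in simp)
    also have "real \<dots> \<le> real (card {..<\<sigma>}) ^ card {..<m} * (1 - 1 / real (card {..<\<sigma>}) ^ k) ^ card S"
    proof (rule card_avoiding_functions)
      show "Q s \<subseteq> {..<m} \<and> card (Q s) \<le> k \<and> c s ` Q s \<subseteq> {..<\<sigma>}" for s
      proof (intro conjI)
        have "card (Q s) \<le> card {p\<in>P. s \<le> p \<and> p < s + m}"
          unfolding Q_def by (rule card_image_le) (use P in simp)
        also have "\<dots> \<le> card P" by (rule card_mono) (use P in auto)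
        finally show "card (Q s) \<le> k" using P(3) by simp
      qed (auto simp: Q_def c_def val)
      show "disjoint_family_on Q S"
        unfolding disjoint_family_on_def
      proof (intro ballI impI equals0I)
        fix s s' q assume s: "s \<in> S" "s' \<in> S" "s \<noteq> s'" "q \<in> Q s \<inter> Q s'"
        then obtain p p' where "p \<in> P" "p' \<in> P" "q = p - s" "s \<le> p" "q = p' - s'" "s' \<le> p'"
          by (auto simp: Q_def)
        then have "p + s' = p' + s" by linarith
        then show False using S(3) s \<open>p \<in> P\<close> \<open>p' \<in> P\<close> by blast
      qed
      show "{..<\<sigma>} \<noteq> {}" using \<sigma> by (simp add: lessThan_empty_iff)
    qed (simp_all add: finS)
    also have "\<dots> = real \<sigma> ^ m * y ^ card S" by (simp add: y_def)
    also have "\<dots> \<le> real \<sigma> ^ m * y ^ r"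
      by (intro mult_left_mono power_decreasing rS y) auto
    finally show ?thesis by simp
  qed
  \<comment> \<open>Union bound: the bad sets would cover all \<open>\<sigma> ^ m\<close> patterns,
    although by \<open>small\<close> their sizes add up to less.\<close>
  have "real (\<sigma> ^ m) = real (card ({..<m} \<rightarrow>\<^sub>E {..<\<sigma>}))" by (simp add: card_PiE)
  also have "\<dots> \<le> real (card (\<Union>l\<in>J. bad l))"
    unfolding of_nat_le_iff by (rule card_mono[OF _ cover]) (use finJ finPiE in \<open>auto simp: bad_def\<close>)
  also have "\<dots> \<le> real (\<Sum>l\<in>J. card (bad l))"
    unfolding of_nat_le_iff by (rule card_UN_le[OF finJ])
  also have "\<dots> \<le> (\<Sum>l\<in>J. real \<sigma> ^ m * y ^ r)"
    unfolding of_nat_sum by (intro sum_mono card_bad)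
  also have "\<dots> = real \<sigma> ^ m * ((real (m + h) * real \<sigma>) ^ k * y ^ r)"
    by (simp add: J_def card_lists_length_eq card_cartesian_product)
  also have "\<dots> < real \<sigma> ^ m * 1" using small \<sigma> by (intro mult_strict_left_mono) (auto simp: y_def)
  finally show False by simp
qed

section \<open>The lower bound on the average search time\<close>

lemma average_search_time_ge:
  assumes "x \<in> patterns \<sigma> m" "\<And>t. t \<in> texts \<sigma> n \<Longrightarrow> b \<le> real (search_time w A \<sigma> x t)"
  shows "b \<le> average_search_time w A \<sigma> m n"
proof -
  have "b \<le> measure_pmf.expectation (random_text \<sigma> n) (\<lambda>t. real (search_time w A \<sigma> x t))"
    by (rule measure_pmf.integral_ge_const)
       (auto simp: AE_measure_pmf_iff set_pmf_random_text assms(2))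
  also have "\<dots> \<le> average_search_time w A \<sigma> m n"
    unfolding average_search_time_def by (rule Max_ge) (use assms(1) in auto)
  finally show ?thesis .
qed

text \<open>With \<open>k\<close> about a quarter of the logarithm, \<open>\<sigma> ^ k\<close> is
  at most \<open>m powr (1/4)\<close>. About \<open>\<delta> * m / ln m ^ 2\<close> independent
  shifts then all fail with probability far below the reciprocal of the number of constraint lists,
  which is only exponential in \<open>ln m ^ 2\<close> up to a constant. The threshold for
  \<open>m\<close> does not depend on \<open>\<sigma>\<close>.\<close>

lemma robust_exists_large:
  assumes "0 < (\<delta>::real)" "\<delta> \<le> 1"
  shows "eventually (\<lambda>m. \<forall>\<sigma>\<ge>2. \<exists>x\<in>patterns \<sigma> m.
    robust \<sigma> (nat \<lfloor>\<delta> * real m\<rfloor>) (Suc (nat \<lfloor>log (real \<sigma>) (real m) / 4\<rfloor>)) x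
     \<and> Suc (nat \<lfloor>log (real \<sigma>) (real m) / 4\<rfloor>) \<le> m) at_top"
proof -
  \<comment> \<open>The comparison of exponents needed at the end. The left side bounds the
    logarithm of \<open>((m + h) * \<sigma>) ^ k\<close> through \<open>h \<le> m\<close>,
    \<open>\<sigma> \<le> m\<close> and \<open>k \<le> ln m\<close>; the right side is a lower bound
    for \<open>r / \<sigma> ^ k\<close>.\<close>
  have "eventually (\<lambda>m::nat. ln (real m) * ln (2 * real m ^ 2) <
      real m powr (-(1/4)) * (\<delta> * real m / ln (real m) ^ 2 - 1)) at_top"
    using assms(1) by real_asymp
  moreover have "eventually (\<lambda>m::nat. ln (real m) + 1 \<le> real m) at_top" by real_asymp
  moreover have "eventually (\<lambda>m::nat. 1 \<le> ln (real m)) at_top" by real_asymp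
  moreover have "eventually (\<lambda>m::nat. 3 \<le> m) at_top" by (rule eventually_ge_at_top)
  ultimately show ?thesis
  proof eventually_elim
    case (elim m)
    show ?case
    proof (intro allI impI)
      fix \<sigma> :: nat assume \<sigma>: "2 \<le> \<sigma>"
      define k where "k = nat \<lfloor>log (real \<sigma>) (real m) / 4\<rfloor>"
      define h where "h = nat \<lfloor>\<delta> * real m\<rfloor>"
      have log0: "0 \<le> log (real \<sigma>) (real m)" using \<sigma> elim by simp
      then have k4: "4 * real k \<le> log (real \<sigma>) (real m)"
        by (simp add: k_def) linarith
      have "ln 2 \<ge> (1/2::real)" using ln2_ge_two_thirds by simp
      moreover have "ln 2 \<le> ln (real \<sigma>)" using \<sigma> by simp
      ultimately have "1 / 2 \<le> ln (real \<sigma>)" by linarith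
      then have "ln (real m) * (1/2) \<le> ln (real m) * ln (real \<sigma>)"
        using elim by (intro mult_left_mono) auto
      then have "log (real \<sigma>) (real m) \<le> 2 * ln (real m)"
        using \<sigma> by (simp add: log_def field_simps)
      then have kln: "real k \<le> ln (real m)" using k4 elim by linarith
      have hm: "real h \<le> \<delta> * real m" "\<delta> * real m < real h + 1"
        using assms(1) by (simp_all add: h_def)
      have "\<delta> * real m \<le> real m" using assms by (simp add: mult_left_le_one_le)
      then have "h \<le> m" using hm by linarith
      have "\<exists>x\<in>patterns \<sigma> m. robust \<sigma> h (Suc k) x"
      \<comment> \<open>If the alphabet is so large that \<open>k = 0\<close>, any pattern will do.
        Otherwise the logarithm of \<open>m\<close> to base \<open>\<sigma>\<close> is at least
        \<open>4\<close>, which gives \<open>\<sigma> \<le> m\<close>.\<close>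
      proof (cases "k = 0")
        case True
        moreover have "replicate m 0 \<in> patterns \<sigma> m" using \<sigma> by (auto simp: patterns_def)
        ultimately show ?thesis using robust_1 by auto
      next
        case False
        \<comment> \<open>The largest \<open>r\<close> with \<open>r * k ^ 2 \<le> Suc h\<close>, as
          \<open>robust_exists\<close> demands.\<close>
        define r where "r = Suc h div k ^ 2"
        have "real (Suc h) < real (k ^ 2 * (r + 1))"
          unfolding of_nat_less_iff r_def using False
          by (metis Suc_eq_plus1 add.commute dividend_less_div_times mult.commute mult_Suc_right
              zero_less_power neq0_conv)
        then have "\<delta> * real m < real k ^ 2 * (real r + 1)" using hm by (simp add: algebra_simps)
        also have "\<dots> \<le> ln (real m) ^ 2 * (real r + 1)"
          using kln by (intro mult_right_mono power_mono) auto
        finally have r: "\<delta> * real m / ln (real m) ^ 2 - 1 \<le> real r"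
          using elim by (simp add: field_simps)
        have sk: "real \<sigma> ^ k \<le> real m powr (1/4)"
        proof -
          have "real \<sigma> ^ k = real \<sigma> powr real k" using \<sigma> by (simp add: powr_realpow)
          also have "\<dots> \<le> real \<sigma> powr (log (real \<sigma>) (real m) * (1/4))"
            using k4 \<sigma> by (intro powr_mono) auto
          also have "\<dots> = (real \<sigma> powr log (real \<sigma>) (real m)) powr (1/4)" by (simp add: powr_powr)
          also have "\<dots> = real m powr (1/4)" using \<sigma> elim by simp
          finally show ?thesis .
        qed
        have sm: "real \<sigma> \<le> real m"
        proof -
          have "real \<sigma> = real \<sigma> powr 1" using \<sigma> by simp
          also have "\<dots> \<le> real \<sigma> powr (log (real \<sigma>) (real m))"
            using k4 False \<sigma> by (intro powr_mono) auto
          also have "\<dots> = real m" using \<sigma> elim by simp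
          finally show ?thesis .
        qed
        define y where "y = 1 / real \<sigma> ^ k"
        have y: "real m powr (-(1/4)) \<le> y" "0 < y" "y \<le> 1"
          using sk \<sigma> elim by (auto simp: y_def powr_minus field_simps)
        have "1 \<le> real m ^ 2" using elim by (intro one_le_power) simp
        then have m2: "1 \<le> 2 * real m ^ 2" by linarith
        have "real (m + h) * real \<sigma> \<le> (2 * real m) * real m"
          using \<open>h \<le> m\<close> sm by (intro mult_mono) auto
        then have "(real (m + h) * real \<sigma>) ^ k \<le> (2 * real m ^ 2) ^ k"
          by (intro power_mono) (auto simp: power2_eq_square)
        also have "\<dots> = exp (real k * ln (2 * real m ^ 2))"
          using elim by (simp add: exp_of_nat_mult)
        also have "\<dots> \<le> exp (ln (real m) * ln (2 * real m ^ 2))"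
          using kln ln_ge_zero[of "2 * real m ^ 2"] m2 by (simp add: mult_right_mono)
        finally have 1: "(real (m + h) * real \<sigma>) ^ k \<le> exp (ln (real m) * ln (2 * real m ^ 2))" .
        have "(1 - y) ^ r \<le> exp (- y) ^ r"
          using y exp_ge_add_one_self[of "- y"] by (intro power_mono) auto
        also have "\<dots> = exp (- (y * real r))" by (simp add: exp_of_nat_mult[symmetric] mult.commute)
        finally have 2: "(1 - y) ^ r \<le> exp (- (y * real r))" .
        have "real m powr (-(1/4)) * (\<delta> * real m / ln (real m) ^ 2 - 1) \<le> real m powr (-(1/4)) * real r"
          by (intro mult_left_mono r) auto
        also have "\<dots> \<le> y * real r" by (intro mult_right_mono y) auto
        finally have 3: "ln (real m) * ln (2 * real m ^ 2) < y * real r" using elim by linarith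
        have "(real (m + h) * real \<sigma>) ^ k * (1 - y) ^ r
            \<le> exp (ln (real m) * ln (2 * real m ^ 2)) * exp (- (y * real r))"
          by (intro mult_mono 1 2) (use y in auto)
        also have "\<dots> < 1" using 3 by (simp add: exp_add[symmetric])
        finally show ?thesis
          using False \<sigma> by (intro robust_exists[of _ _ r]) (auto simp: r_def y_def)
      qed
      moreover have "Suc k \<le> m" using kln elim by linarith
      ultimately show "\<exists>x\<in>patterns \<sigma> m. robust \<sigma> (nat \<lfloor>\<delta> * real m\<rfloor>) (Suc (nat \<lfloor>log (real \<sigma>) (real m) / 4\<rfloor>)) x
         \<and> Suc (nat \<lfloor>log (real \<sigma>) (real m) / 4\<rfloor>) \<le> m"
        by (auto simp: k_def h_def)
    qed
  qed
qed

text \<open>Every text, not only the average one, costs \<open>k\<close> reads in each of the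
  \<open>n div (m + h)\<close> blocks for the chosen pattern. What remains is to compare this
  product with \<open>n * log \<sigma> m / m\<close>.\<close>

lemma average_search_time_lower_bound:
  fixes \<epsilon> :: real
  assumes "\<epsilon> > 0"
  shows "\<exists>c::real>0. \<forall>A \<sigma> m n w. 2 \<le> \<sigma> \<and> 1 \<le> m \<and> (1 + \<epsilon>) * real m \<le> real n \<and> solves w A \<sigma> m n \<longrightarrow>
    c * (real n * log (real \<sigma>) (real m) / real m) \<le> average_search_time w A \<sigma> m n"
proof -
  \<comment> \<open>Capped at \<open>1\<close>, so that a block is no longer than
    \<open>2 * m\<close>.\<close>
  define \<delta> where "\<delta> = min \<epsilon> 1"
  have \<delta>: "0 < \<delta>" "\<delta> \<le> 1" "\<delta> \<le> \<epsilon>" using assms by (auto simp: \<delta>_def)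
  define pat where "pat \<sigma> m x k \<longleftrightarrow> x \<in> patterns \<sigma> m \<and> robust \<sigma> (nat \<lfloor>\<delta> * real m\<rfloor>) k x \<and> k \<le> m"
    for \<sigma> m x k
  obtain m1 where m1: "\<And>m \<sigma>. m1 \<le> m \<Longrightarrow> 2 \<le> \<sigma> \<Longrightarrow>
      \<exists>x. pat \<sigma> m x (Suc (nat \<lfloor>log (real \<sigma>) (real m) / 4\<rfloor>))"
    using robust_exists_large[OF \<delta>(1,2)] unfolding eventually_at_top_linorder pat_def by blast
  \<comment> \<open>The value \<open>1/16\<close> makes \<open>4 * c * lg\<close> at most
    \<open>lg / 4\<close>, hence at most \<open>k\<close>, for large \<open>m\<close>. The other
    value makes it at most \<open>1\<close> for \<open>m < m1\<close>, where
    \<open>lg \<le> m1 + 1\<close>.\<close>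
  define c where "c = min (1/16) (1 / (4 * (real m1 + 1)))"
  have c: "0 < c" "c \<le> 1/16" "c \<le> 1 / (4 * (real m1 + 1))" by (auto simp: c_def)
  show ?thesis
  proof (intro exI[of _ c] conjI allI impI c(1), elim conjE)
    fix A \<sigma> m n w
    assume \<sigma>: "2 \<le> \<sigma>" and m: "1 \<le> m" and n: "(1 + \<epsilon>) * real m \<le> real n" and sol: "solves w A \<sigma> m n"
    define h where "h = nat \<lfloor>\<delta> * real m\<rfloor>"
    have h: "real h \<le> \<delta> * real m" using \<delta> by (simp add: h_def)
    define lg where "lg = log (real \<sigma>) (real m)"
    have lg0: "0 \<le> lg" using \<sigma> m by (simp add: lg_def)
    have "\<exists>x k. pat \<sigma> m x k \<and> 4 * c * lg \<le> real k"
    proof (cases "m1 \<le> m")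
      case True
      from m1[OF this \<sigma>] obtain x where "pat \<sigma> m x (Suc (nat \<lfloor>lg / 4\<rfloor>))" by (auto simp: lg_def)
      moreover have "4 * c * lg \<le> 4 * (1/16) * lg" using c lg0 by (intro mult_right_mono) auto
      moreover have "lg / 4 \<le> real (Suc (nat \<lfloor>lg / 4\<rfloor>))" using lg0 by simp linarith
      ultimately show ?thesis by (intro exI[of _ x] exI conjI) (assumption, linarith)
    next
      case False
      have "lg \<le> log 2 (real m)"
        using \<sigma> m by (simp add: lg_def log_def frac_le)
      also have "\<dots> \<le> real m" using log_of_power_le[of m 2 m] less_exp[of m] m by simp
      finally have "lg \<le> real m1 + 1" using False by simp
      then have "4 * c * lg \<le> 4 * (1 / (4 * (real m1 + 1))) * (real m1 + 1)"
        using c lg0 by (intro mult_mono) auto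
      also have "\<dots> = 1" by simp
      finally have "4 * c * lg \<le> real 1" by simp
      moreover have "pat \<sigma> m (replicate m 0) 1"
        using \<sigma> m robust_1 by (auto simp: pat_def patterns_def)
      ultimately show ?thesis by blast
    qed
    then obtain x k where x: "x \<in> patterns \<sigma> m" and rob: "robust \<sigma> h k x" and k: "k \<le> m"
      and ck: "4 * c * lg \<le> real k" by (auto simp: pat_def h_def)
    define B where "B = n div (m + h)"
    \<comment> \<open>At least one whole block fits into the text, so rounding the number of blocks
      down loses at most a factor \<open>2\<close>.\<close>
    have "real (m + h) \<le> (1 + \<epsilon>) * real m"
      using h mult_right_mono[OF \<delta>(3), of "real m"] by (simp add: algebra_simps)
    then have "m + h \<le> n" using n by linarith
    then have "1 \<le> B" using m by (simp add: B_def div_greater_zero_iff Suc_le_eq)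
    have "n < (B + 1) * (m + h)" using m unfolding B_def
      by (metis add.commute add_gr_0 dividend_less_div_times distrib_right mult_1 zero_less_one
          order_less_le_trans)
    also have "\<dots> \<le> (2 * B) * (m + h)" using \<open>1 \<le> B\<close> by (intro mult_right_mono) auto
    also have "\<dots> \<le> (2 * B) * (2 * m)"
    proof (intro mult_left_mono)
      have "\<delta> * real m \<le> real m" using \<delta> by (simp add: mult_left_le_one_le)
      then show "m + h \<le> 2 * m" using h by linarith
    qed auto
    finally have "real n \<le> real (2 * B * (2 * m))" unfolding of_nat_le_iff by (rule less_imp_le)
    then have "real n \<le> 4 * real B * real m" by simp
    then have nB: "real n / real m \<le> 4 * real B" using m by (simp add: field_simps)
    have "c * (real n * log (real \<sigma>) (real m) / real m) = (real n / real m) * (c * lg)"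
      by (simp add: lg_def)
    also have "\<dots> \<le> (4 * real B) * (c * lg)" using nB c lg0 by (intro mult_right_mono) auto
    also have "\<dots> = (4 * c * lg) * real B" by simp
    also have "\<dots> \<le> real k * real B" using ck by (intro mult_right_mono) auto
    also have "\<dots> \<le> average_search_time w A \<sigma> m n"
    proof (rule average_search_time_ge[OF x])
      fix t assume "t \<in> texts \<sigma> n"
      from robust_search_time[OF sol x this \<sigma> rob k m]
      show "real k * real B \<le> real (search_time w A \<sigma> x t)"
        unfolding B_def by (metis of_nat_le_iff of_nat_mult)
    qed
    finally show "c * (real n * log (real \<sigma>) (real m) / real m) \<le> average_search_time w A \<sigma> m n" .
  qed
qed

subsection \<open>A calculus for timed runs\<close>

text \<open>The elapsed time is threaded through as a ghost argument of the postcondition.\<close>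

definition wp :: "nat \<Rightarrow> nat list \<Rightarrow> com \<Rightarrow> (nat \<Rightarrow> ram \<Rightarrow> bool) \<Rightarrow> nat \<Rightarrow> ram \<Rightarrow> bool" where
  "wp w inp c Q k s \<longleftrightarrow> (\<exists>j s'. exec w inp c s j s' \<and> Q (k + j) s')"

fun block :: "instr list \<Rightarrow> com" where
  "block [] = Instr (Const 0 0)"
| "block [i] = Instr i"
| "block (i # is) = Seq (Instr i) (block is)"

lemma exec_block: "is \<noteq> [] \<Longrightarrow> exec w inp (block is) s (length is) (fold (step w inp) is s)"
proof (induction "is" arbitrary: s rule: block.induct)
  case (3 i j "is")
  then show ?case using exec.Seq[OF exec.Instr[of w inp i s] "3.IH"] by simp
qed (use exec.Instr in auto)

declare block.simps [simp del]

lemma wp_block: "Q (k + length (i # is)) (fold (step w inp) (i # is) s) \<Longrightarrow> wp w inp (block (i # is)) Q k s"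
  unfolding wp_def using exec_block[of "i # is"] by blast

lemma wp_instr: "Q (k + 1) (step w inp i s) \<Longrightarrow> wp w inp (Instr i) Q k s"
  unfolding wp_def using exec.Instr by blast

lemma wp_seq: "wp w inp c (wp w inp d Q) k s \<Longrightarrow> wp w inp (Seq c d) Q k s"
  unfolding wp_def using exec.Seq by (metis add.assoc)

lemma wp_if:
  assumes "reg s a < reg s b \<Longrightarrow> wp w inp c Q (Suc k) s" "\<not> reg s a < reg s b \<Longrightarrow> wp w inp d Q (Suc k) s"
  shows "wp w inp (IfLess a b c d) Q k s"
  using assms exec.IfTrue exec.IfFalse unfolding wp_def by (metis add_Suc add_Suc_right)

lemmas wp_rules = wp_block wp_instr wp_seq wp_if

lemma wp_while:
  assumes init: "I 0 s"
    and guard: "\<And>i s. i \<le> N \<Longrightarrow> I i s \<Longrightarrow> reg s a < reg s b \<longleftrightarrow> i < N"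
    and body: "\<And>i s. i < N \<Longrightarrow> I i s \<Longrightarrow> wp w inp c (\<lambda>k s. I (Suc i) s \<and> k \<le> T i) 0 s"
    and post: "\<And>k' s. I N s \<Longrightarrow> k' \<le> k + Suc (\<Sum>i<N. Suc (T i)) \<Longrightarrow> Q k' s"
  shows "wp w inp (WhileLess a b c) Q k s"
proof -
  have "\<exists>l s'. exec w inp (WhileLess a b c) s l s' \<and> l \<le> Suc (\<Sum>j=i..<N. Suc (T j)) \<and> I N s'"
    if "I i s" "i \<le> N" for i s
    using that(2,1)
  proof (induction i arbitrary: s rule: inc_induct)
    case base
    then have "\<not> reg s a < reg s b" using guard by blast
    then have "exec w inp (WhileLess a b c) s 1 s" by (rule exec.WhileFalse)
    then show ?case using base by auto
  next
    case (step i)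
    then have *: "reg s a < reg s b" using guard[of i s] by simp
    from body[OF step.hyps(2) step.prems] obtain j s' where
      1: "exec w inp c s j s'" "j \<le> T i" "I (Suc i) s'" by (auto simp: wp_def)
    from step.IH[OF 1(3)] obtain l s'' where
      2: "exec w inp (WhileLess a b c) s' l s''" "l \<le> Suc (\<Sum>j=Suc i..<N. Suc (T j))" "I N s''"
      by auto
    have "(\<Sum>j=i..<N. Suc (T j)) = Suc (T i) + (\<Sum>j=Suc i..<N. Suc (T j))"
      using step.hyps by (simp add: sum.atLeast_Suc_lessThan)
    then show ?case using exec.WhileTrue[OF * 1(1) 2(1)] 1(2) 2(2,3)
      by (intro exI[of _ "Suc (j + l)"] exI[of _ s'']) simp
  qed
  from this[of 0 s] init obtain l s' where "exec w inp (WhileLess a b c) s l s'"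
    "l \<le> Suc (\<Sum>j<N. Suc (T j))" "I N s'"
    by (auto simp: atLeast0LessThan)
  then show ?thesis unfolding wp_def using post[of s' "k + l"] by auto
qed

subsection \<open>Parameters of the algorithm\<close>

text \<open>For \<open>m \<ge> 1\<close> this is three times the logarithm of \<open>m\<close> to
  base \<open>(\<sigma> + 1) / 2\<close>, rounded up. The integer form lets the machine find it by
  comparing two running powers.\<close>

definition min_gram_length :: "nat \<Rightarrow> nat \<Rightarrow> nat" where
  "min_gram_length \<sigma> m = (LEAST l. m ^ 3 * 2 ^ l \<le> (\<sigma> + 1) ^ l)"

definition table_size :: "nat \<Rightarrow> nat \<Rightarrow> nat" where
  "table_size \<sigma> m = m ^ 3 * 2 ^ min_gram_length \<sigma> m"

text \<open>Gram length \<open>0\<close> makes every window a hit, hence the search naive.\<close>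
definition gram_length :: "nat \<Rightarrow> nat \<Rightarrow> nat" where
  "gram_length \<sigma> m = (if m < 2 * min_gram_length \<sigma> m then 0 else min_gram_length \<sigma> m)"

text \<open>Register \<open>20\<close> is never written and stays \<open>0\<close>; writing register \<open>8\<close> serves as a no-op.\<close>
definition params :: com where
  "params = Seq (block [Const 3 1, Arith Add 4 0 3, Arith Mul 6 1 1, Arith Mul 6 6 1, Const 7 1, Const 5 0])
    (Seq (WhileLess 7 6 (block [Arith Mul 7 7 4, Arith Add 6 6 6, Arith Add 5 5 3]))
    (Seq (block [Arith Add 8 5 5])
    (Seq (IfLess 1 8 (Instr (Const 5 0)) (Instr (Const 8 0)))
    (block [Arith Sub 9 1 5, Arith Add 9 9 3]))))"

text \<open>The base \<open>(\<sigma> + 1) / 2\<close> is at least \<open>3/2\<close>, and powers of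
  \<open>3/2\<close> exceed \<open>m ^ 3\<close> eventually.\<close>

lemma min_gram_length_ex:
  fixes m :: nat
  assumes "2 \<le> \<sigma>" shows "\<exists>l. m ^ 3 * 2 ^ l \<le> (\<sigma> + 1) ^ l"
proof -
  obtain l where l: "real (m ^ 3) < (3/2) ^ l" using real_arch_pow[of "3/2"] by auto
  then have "real (m ^ 3) * 2 ^ l \<le> 3 ^ l" by (simp add: power_divide field_simps)
  then have "real (m ^ 3 * 2 ^ l) \<le> real (3 ^ l)" by simp
  then have "m ^ 3 * 2 ^ l \<le> 3 ^ l" using of_nat_le_iff by blast
  also have "\<dots> \<le> (\<sigma> + 1) ^ l" using assms by (intro power_mono) auto
  finally show ?thesis by blast
qed

lemma min_gram_length_less:
  assumes "i < min_gram_length \<sigma> m"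
  shows "(\<sigma> + 1) ^ i < m ^ 3 * 2 ^ i"
  using assms not_less_Least[of i] unfolding min_gram_length_def by force

lemma min_gram_length_ge:
  assumes "2 \<le> \<sigma>"
  shows "table_size \<sigma> m \<le> (\<sigma> + 1) ^ min_gram_length \<sigma> m"
  using LeastI_ex[OF min_gram_length_ex[OF assms]] unfolding table_size_def min_gram_length_def .

text \<open>By minimality the predecessor \<open>l\<close> satisfies
  \<open>(3/2) ^ l < m ^ 3\<close>. Squaring and \<open>2 \<le> 9/4\<close> give
  \<open>2 ^ l \<le> m ^ 6\<close>; the factor \<open>2\<close> accounts for the last step from
  \<open>l\<close>.\<close>

lemma two_power_min_gram_length:
  assumes "2 \<le> \<sigma>" "1 \<le> m"
  shows "2 ^ min_gram_length \<sigma> m \<le> 2 * m ^ 6"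
proof (cases "min_gram_length \<sigma> m")
  case (Suc l)
  have "3 ^ l \<le> (\<sigma> + 1) ^ l" using assms by (intro power_mono) auto
  also have "\<dots> < m ^ 3 * 2 ^ l" by (rule min_gram_length_less) (simp add: Suc)
  finally have "((3::nat) ^ l) ^ 2 \<le> (m ^ 3 * 2 ^ l) ^ 2" by (intro power_mono) auto
  then have 1: "(9::nat) ^ l \<le> m ^ 6 * 4 ^ l"
    by (simp add: power_mult_distrib power_mult[symmetric] mult.commute[of _ 2])
       (simp add: power_mult)
  have "(4::nat) ^ l * 2 ^ l = 8 ^ l" by (simp add: power_mult_distrib[symmetric])
  also have "(8::nat) ^ l \<le> 9 ^ l" by (intro power_mono) auto
  finally have "4 ^ l * 2 ^ l \<le> m ^ 6 * (4::nat) ^ l" using 1 by linarith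
  then have "2 ^ l \<le> m ^ 6" by simp
  with Suc show ?thesis by simp
qed (use assms in simp)

text \<open>One step before the minimum the power is below \<open>m ^ 3 * 2 ^ l \<le> m ^ 9\<close>,
  and the last step multiplies it by \<open>\<sigma> + 1\<close>. This is what keeps the codes of
  grams within a machine word.\<close>

lemma power_min_gram_length:
  assumes "2 \<le> \<sigma>" "1 \<le> m"
  shows "(\<sigma> + 1) ^ min_gram_length \<sigma> m \<le> m ^ 9 * (\<sigma> + 1)"
proof (cases "min_gram_length \<sigma> m")
  case (Suc l)
  have "(\<sigma> + 1) ^ l \<le> m ^ 3 * 2 ^ l" using min_gram_length_less[of l \<sigma> m] Suc by simp
  also have "\<dots> \<le> m ^ 3 * m ^ 6" using two_power_min_gram_length[OF assms] Suc by (intro mult_left_mono) auto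
  also have "\<dots> = m ^ 9" by (simp add: power_add[symmetric])
  finally have "(\<sigma> + 1) ^ l * (\<sigma> + 1) \<le> m ^ 9 * (\<sigma> + 1)" by (rule mult_right_mono) simp
  then show ?thesis using Suc by (simp add: mult.commute)
next
  case 0
  have "1 * 1 \<le> m ^ 9 * (\<sigma> + 1)" using assms by (intro mult_mono) auto
  with 0 show ?thesis by simp
qed

lemma take_bit_sub:
  assumes "b \<le> a" "a < 2 ^ w"
  shows "take_bit w (a + 2 ^ w - b) = (a - b :: nat)"
proof -
  have "a + 2 ^ w - b = a - b + 2 ^ w" using assms(1) by simp
  then have "take_bit w (a + 2 ^ w - b) = (a - b) mod 2 ^ w"
    unfolding take_bit_eq_mod by (simp only: mod_add_self2)
  with assms(2) show ?thesis by simp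
qed

text \<open>The assumption on \<open>w\<close> is the integer form of a word size of at least
  \<open>20 * log 2 (n + \<sigma>)\<close> bits. It leaves room for the computed values, which stay
  below a fixed power of \<open>n + \<sigma>\<close>.\<close>

locale word_size =
  fixes \<sigma> m n w :: nat
  assumes \<sigma>: "2 \<le> \<sigma>" and m: "1 \<le> m" and mn: "m < n" and w: "(n + \<sigma>) ^ 20 \<le> 2 ^ w"
begin

abbreviation "M \<equiv> table_size \<sigma> m"
abbreviation "L \<equiv> gram_length \<sigma> m"
abbreviation "D \<equiv> m - L + 1"

lemma word: "v \<le> (n + \<sigma>) ^ 14 \<Longrightarrow> v < 2 ^ w"
proof -
  assume "v \<le> (n + \<sigma>) ^ 14"
  also have "\<dots> < (n + \<sigma>) ^ 20" using \<sigma> by (intro power_strict_increasing) auto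
  finally show ?thesis using w by linarith
qed

lemma gram_length_le: "2 * L \<le> m" by (simp add: gram_length_def)

lemma table_size_pos: "0 < M" using m by (simp add: table_size_def)

lemma table_size_ge: "m \<le> M"
proof -
  have "m * 1 * 1 \<le> m * m ^ 2 * 2 ^ min_gram_length \<sigma> m" using m by (intro mult_mono) auto
  also have "\<dots> = M" by (simp add: table_size_def numeral_3_eq_3 power2_eq_square)
  finally show ?thesis by simp
qed

text \<open>Everything is measured in powers of \<open>n + \<sigma>\<close>: exponent
  \<open>10\<close> comes from \<open>m ^ 9 * (\<sigma> + 1)\<close> and exponent \<open>7\<close>
  from \<open>2 * m ^ 6\<close>. Exponent \<open>14\<close> leaves room for a sum of four such
  quantities.\<close>

lemma bounds:
  "\<sigma> + 1 \<le> n + \<sigma>" "m \<le> n + \<sigma>" "4 \<le> n + \<sigma>" "n + \<sigma> \<le> (n + \<sigma>) ^ 10"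
  "M \<le> (n + \<sigma>) ^ 10" "(\<sigma> + 1) ^ min_gram_length \<sigma> m \<le> (n + \<sigma>) ^ 10"
  "(\<sigma> + 1) ^ L \<le> (n + \<sigma>) ^ 10"
  "2 ^ min_gram_length \<sigma> m \<le> (n + \<sigma>) ^ 7" "2 ^ L \<le> (n + \<sigma>) ^ 7" "4 * (n + \<sigma>) ^ 10 \<le> (n + \<sigma>) ^ 14"
proof -
  show 1: "\<sigma> + 1 \<le> n + \<sigma>" "m \<le> n + \<sigma>" "4 \<le> n + \<sigma>" using \<sigma> m mn by auto
  have "(n + \<sigma>) ^ 1 \<le> (n + \<sigma>) ^ 10" using 1 by (intro power_increasing) auto
  then show "n + \<sigma> \<le> (n + \<sigma>) ^ 10" by simp
  have "(\<sigma> + 1) ^ min_gram_length \<sigma> m \<le> m ^ 9 * (\<sigma> + 1)" by (rule power_min_gram_length[OF \<sigma> m])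
  also have "\<dots> \<le> (n + \<sigma>) ^ 9 * (n + \<sigma>)" using 1 by (intro mult_mono power_mono) auto
  finally show 2: "(\<sigma> + 1) ^ min_gram_length \<sigma> m \<le> (n + \<sigma>) ^ 10" by (simp add: power_Suc2[symmetric] del: power_Suc)
  then show "M \<le> (n + \<sigma>) ^ 10" using min_gram_length_ge[OF \<sigma>, of m] by linarith
  have "(\<sigma> + 1) ^ L \<le> (\<sigma> + 1) ^ min_gram_length \<sigma> m" by (intro power_increasing) (auto simp: gram_length_def)
  then show "(\<sigma> + 1) ^ L \<le> (n + \<sigma>) ^ 10" using 2 by linarith
  have "2 * m ^ 6 \<le> (n + \<sigma>) * (n + \<sigma>) ^ 6" using 1 by (intro mult_mono power_mono) auto
  also have "\<dots> = (n + \<sigma>) ^ 7" by (simp add: power_Suc[symmetric] del: power_Suc)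
  finally show 3: "2 ^ min_gram_length \<sigma> m \<le> (n + \<sigma>) ^ 7" using two_power_min_gram_length[OF \<sigma> m] by linarith
  have "2 ^ L \<le> (2::nat) ^ min_gram_length \<sigma> m" by (intro power_increasing) (auto simp: gram_length_def)
  then show "2 ^ L \<le> (n + \<sigma>) ^ 7" using 3 by linarith
  have "4 * (n + \<sigma>) ^ 10 \<le> (n + \<sigma>) ^ 4 * (n + \<sigma>) ^ 10"
    using 1 self_le_power[of "n + \<sigma>" 4] by (intro mult_right_mono) auto
  also have "\<dots> = (n + \<sigma>) ^ 14" by (simp add: power_add[symmetric])
  finally show "4 * (n + \<sigma>) ^ 10 \<le> (n + \<sigma>) ^ 14" .
qed

lemma word_small: "v \<le> 4 * (n + \<sigma>) ^ 10 \<Longrightarrow> take_bit w v = v"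
  by (intro take_bit_nat_eq_self word order.trans[OF _ bounds(10)])

text \<open>The register convention that \<open>params\<close> establishes and all later code relies
  on.\<close>

definition env :: "ram \<Rightarrow> bool" where
  "env s \<longleftrightarrow> reg s 0 = \<sigma> \<and> reg s 1 = m \<and> reg s 3 = 1 \<and> reg s 4 = \<sigma> + 1 \<and> reg s 5 = L \<and>
     reg s 6 = M \<and> reg s 9 = D \<and> reg s 20 = 0"

text \<open>The loop stops when \<open>(\<sigma> + 1) ^ i\<close> catches up with
  \<open>m ^ 3 * 2 ^ i\<close>, by minimality exactly at \<open>min_gram_length\<close>, and leaves
  \<open>M\<close> in register \<open>6\<close>. Both programs begin with this computation, because
  the search inherits memory but no registers; hence memory and register \<open>2\<close> must be
  left alone.\<close>

lemma wp_params:
  assumes s: "reg s 0 = \<sigma>" "reg s 1 = m" "reg s 20 = 0"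
    and post: "\<And>k' s'. env s' \<Longrightarrow> reg s' 2 = reg s 2 \<Longrightarrow> mem s' = mem s \<Longrightarrow> out s' = out s \<Longrightarrow>
       used s' = used s \<Longrightarrow> k' \<le> k + 12 + 4 * min_gram_length \<sigma> m \<Longrightarrow> Q k' s'"
  shows "wp w inp params Q k s"
proof -
  have m3: "m * m * m = m ^ 3" by (simp add: numeral_3_eq_3)
  have "m ^ 3 * 1 \<le> m ^ 3 * 2 ^ min_gram_length \<sigma> m" by (intro mult_left_mono) auto
  then have m3M: "m ^ 3 \<le> M" by (simp add: table_size_def)
  have "m * m * 1 \<le> m * m * m" using m by (intro mult_left_mono) auto
  then have m2M: "m * m \<le> M" using m3 m3M by simp
  have l: "min_gram_length \<sigma> m \<le> (n + \<sigma>) ^ 10" using less_exp[of "min_gram_length \<sigma> m"] bounds(8)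
      power_increasing[of 7 10 "n + \<sigma>"] bounds(3) by linarith
  have b2: "1 \<le> (n + \<sigma>) ^ 10" using bounds(3,4) by linarith
  have tb: "take_bit w (Suc \<sigma>) = Suc \<sigma>" "take_bit w (Suc 0) = Suc 0" "take_bit w (m * m) = m * m"
    "take_bit w (m ^ 3) = m ^ 3"
    using bounds m2M m3M b2 by (intro word_small; linarith)+
  have "0 < w" using word_small[of 1] b2 by (cases w) auto
  define I where "I i s' \<longleftrightarrow> reg s' 0 = \<sigma> \<and> reg s' 1 = m \<and> reg s' 3 = 1 \<and> reg s' 4 = \<sigma> + 1 \<and>
    reg s' 5 = i \<and> reg s' 6 = m ^ 3 * 2 ^ i \<and> reg s' 7 = (\<sigma> + 1) ^ i \<and> reg s' 20 = 0 \<and>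
    reg s' 2 = reg s 2 \<and> mem s' = mem s \<and> out s' = out s \<and> used s' = used s" for i and s' :: ram
  have "L \<le> m" using gram_length_le by simp
  have tb2: "take_bit w (min_gram_length \<sigma> m + min_gram_length \<sigma> m) = min_gram_length \<sigma> m + min_gram_length \<sigma> m"
    "take_bit w (Suc m) = Suc m" "take_bit w (Suc (m - min_gram_length \<sigma> m)) = Suc (m - min_gram_length \<sigma> m)"
    using bounds l by (intro word_small; linarith)+
  have wm: "m < 2 ^ w" using bounds by (intro word) linarith
  note tb3 = take_bit_sub[of 0 m w, simplified, OF wm]
  note tb4 = take_bit_sub[of "min_gram_length \<sigma> m" m w, OF _ wm]
  show ?thesis unfolding params_def
  proof (intro wp_rules, rule wp_while[where I = I and N = "min_gram_length \<sigma> m" and T = "\<lambda>_. 3"])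
    fix i s' assume i: "i \<le> min_gram_length \<sigma> m" and I: "I i s'"
    have "i < min_gram_length \<sigma> m \<longleftrightarrow> (\<sigma> + 1) ^ i < m ^ 3 * 2 ^ i"
      using min_gram_length_less[of i \<sigma> m] min_gram_length_ge[OF \<sigma>, of m] i by (auto simp: table_size_def le_less)
    then show "(reg s' 7 < reg s' 6) = (i < min_gram_length \<sigma> m)" using I by (simp add: I_def)
  next
    fix i s' assume i: "i < min_gram_length \<sigma> m" and I: "I i s'"
    have "(\<sigma> + 1) ^ Suc i \<le> (\<sigma> + 1) ^ min_gram_length \<sigma> m" using i by (intro power_increasing) auto
    moreover have "(2::nat) ^ Suc i \<le> 2 ^ min_gram_length \<sigma> m" using i by (intro power_increasing) auto
    then have "m ^ 3 * 2 ^ Suc i \<le> M" unfolding table_size_def by (intro mult_left_mono) auto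
    ultimately have tbi: "take_bit w (Suc i) = Suc i" "take_bit w ((\<sigma> + 1) ^ i * (\<sigma> + 1)) = (\<sigma> + 1) ^ Suc i"
      "take_bit w (m ^ 3 * 2 ^ i + m ^ 3 * 2 ^ i) = m ^ 3 * 2 ^ Suc i"
      using word_small[of "Suc i"] word_small[of "(\<sigma> + 1) ^ Suc i"] word_small[of "m ^ 3 * 2 ^ Suc i"]
        bounds(5,6) i l by (simp_all add: mult_2_right mult_2 mult.commute add_mult_distrib2)
    show "wp w inp (block [Arith Mul 7 7 4, Arith Add 6 6 6, Arith Add 5 5 3])
        (\<lambda>k s. I (Suc i) s \<and> k \<le> 3) 0 s'"
      by (intro wp_rules) (use I tbi in \<open>simp_all add: I_def mult.commute\<close>)
  next
    fix k' s' assume I: "I (min_gram_length \<sigma> m) s'" and k': "k' \<le> k + length [Const 3 1, Arith Add 4 0 3,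
        Arith Mul 6 1 1, Arith Mul 6 6 1, Const 7 1, Const 5 0] + Suc (\<Sum>i<min_gram_length \<sigma> m. Suc 3)"
    show "wp w inp (Seq (block [Arith Add 8 5 5]) (Seq (IfLess 1 8 (Instr (Const 5 0)) (Instr (Const 8 0)))
        (block [Arith Sub 9 1 5, Arith Add 9 9 3]))) Q k' s'"
      by (intro wp_rules post)
        (use I k' in \<open>simp_all add: I_def env_def tb tb2 tb3 tb4 gram_length_def table_size_def split: if_splits\<close>)
  qed (use s \<open>0 < w\<close> in \<open>simp_all add: I_def tb m3\<close>)
qed

end

subsection \<open>Preprocessing\<close>

text \<open>Most significant digit first, so that one further character costs one multiplication and
  one addition.\<close>

definition radix_code :: "nat \<Rightarrow> nat list \<Rightarrow> nat" where
  "radix_code b cs = foldl (\<lambda>c a. c * b + a) 0 cs"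

lemma radix_code_Nil [simp]: "radix_code b [] = 0"
  by (simp add: radix_code_def)

lemma radix_code_snoc [simp]: "radix_code b (cs @ [a]) = radix_code b cs * b + a"
  by (simp add: radix_code_def)

lemma radix_code_less: "set cs \<subseteq> {..<b} \<Longrightarrow> radix_code b cs < b ^ length cs"
proof (induction cs rule: rev_induct)
  case (snoc a cs)
  then have "radix_code b cs * b + a < (radix_code b cs + 1) * b" by simp
  also have "\<dots> \<le> b ^ length cs * b" using snoc by (intro mult_right_mono) auto
  finally show ?case by (simp add: mult.commute)
qed simp

lemma radix_code_inj:
  assumes "set cs \<subseteq> {..<b}" "set ds \<subseteq> {..<b}" "length cs = length ds" "radix_code b cs = radix_code b ds"
  shows "cs = ds"
  using assms
proof (induction cs arbitrary: ds rule: rev_induct)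
  case (snoc a cs)
  then obtain e es where ds: "ds = es @ [e]" by (cases ds rule: rev_cases) auto
  have "a < b" "e < b" using snoc.prems by (auto simp: ds)
  moreover have eq: "radix_code b cs * b + a = radix_code b es * b + e" using snoc.prems by (simp add: ds)
  ultimately have "radix_code b cs = radix_code b es"
    by (metis add.right_neutral div_less div_mult_self3 less_nat_zero_code)
  moreover from this eq have "a = e" by simp
  ultimately show ?case using snoc by (simp add: ds)
qed simp

text \<open>The low \<open>gram_length\<close> bits of \<open>q\<close> are the mask of wildcards, the remaining ones the position of
  the factor.\<close>
definition gram :: "nat \<Rightarrow> nat list \<Rightarrow> nat \<Rightarrow> nat \<Rightarrow> nat" where
  "gram \<sigma> x q j = (if bit q j then \<sigma> else x ! (q div 2 ^ gram_length \<sigma> (length x) + j))"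

text \<open>Different words may share an index. Such collisions are harmless for correctness: they
  cause additional hits, which the verification sorts out.\<close>

definition gram_index :: "nat \<Rightarrow> nat list \<Rightarrow> nat \<Rightarrow> nat" where
  "gram_index \<sigma> x q = radix_code (\<sigma> + 1) (map (gram \<sigma> x q) [0..<gram_length \<sigma> (length x)]) mod table_size \<sigma> (length x)"

text \<open>The memory after \<open>q\<close> rounds of marking: the table of marks, followed by the pattern.\<close>
definition table :: "nat \<Rightarrow> nat list \<Rightarrow> nat \<Rightarrow> nat \<Rightarrow> nat" where
  "table \<sigma> x q a = (if a \<in> gram_index \<sigma> x ` {..<q} then 1
     else if table_size \<sigma> (length x) \<le> a \<and> a < table_size \<sigma> (length x) + length x then x ! (a - table_size \<sigma> (length x)) else 0)"

text \<open>The input of the search is the text, so the pattern has to be handed over in memory,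
  behind the table of marks.\<close>

definition store_pattern :: com where
  "store_pattern = WhileLess 10 1 (block [Read 11 10, Arith Add 12 6 10, Store 12 11, Arith Add 10 10 3])"

text \<open>Register \<open>10\<close> holds the position of the factor, \<open>14\<close> the
  number \<open>q\<close>, \<open>15\<close> the code so far, \<open>16\<close> the index
  \<open>j\<close>, \<open>18\<close> the current character and \<open>19\<close> its mask bit. A
  set bit replaces the character by \<open>\<sigma>\<close>, the encoding of the wildcard.\<close>

definition gram_code :: com where
  "gram_code = WhileLess 16 5 (Seq (block [Arith Add 18 10 16, Read 18 18, Arith Shr 19 14 16, Arith And 19 19 3])
     (Seq (IfLess 20 19 (Instr (Arith Add 18 0 20)) (Instr (Const 8 0)))
       (block [Arith Mul 15 15 4, Arith Add 15 15 18, Arith Add 16 16 3])))"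

definition mark_grams :: com where
  "mark_grams = WhileLess 14 13 (Seq (block [Arith Shr 10 14 5, Const 15 0, Const 16 0])
     (Seq gram_code (block [Arith Mod 15 15 6, Store 15 3, Arith Add 14 14 3])))"

definition preprocessing :: com where
  "preprocessing = Seq params (Seq (block [Const 10 0]) (Seq store_pattern
     (Seq (block [Arith Shl 13 9 5, Const 14 0]) mark_grams)))"

context word_size begin

lemma mask_count_bound: "D * 2 ^ L \<le> (n + \<sigma>) ^ 10"
proof -
  have "D \<le> n + \<sigma>" using mn \<sigma> by simp
  then have "D * 2 ^ L \<le> (n + \<sigma>) * (n + \<sigma>) ^ 7" using bounds by (intro mult_mono) auto
  also have "\<dots> = (n + \<sigma>) ^ 8" by (simp add: power_Suc[symmetric] del: power_Suc)
  also have "\<dots> \<le> (n + \<sigma>) ^ 10" using bounds(3) by (intro power_increasing) auto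
  finally show "D * 2 ^ L \<le> (n + \<sigma>) ^ 10" .
qed

lemma radix_code_step_small:
  assumes "\<And>i. i \<le> j \<Longrightarrow> f i \<le> \<sigma>" "j < L"
  shows "take_bit w (radix_code (\<sigma> + 1) (map f [0..<j]) * (\<sigma> + 1)) = radix_code (\<sigma> + 1) (map f [0..<j]) * (\<sigma> + 1)"
    "take_bit w (radix_code (\<sigma> + 1) (map f [0..<j]) * (\<sigma> + 1) + f j) = radix_code (\<sigma> + 1) (map f [0..<Suc j])"
    "radix_code (\<sigma> + 1) (map f [0..<Suc j]) \<le> (n + \<sigma>) ^ 10"
proof -
  have "set (map f [0..<Suc j]) \<subseteq> {..<\<sigma> + 1}" using assms by (auto simp: less_Suc_eq_le)
  from radix_code_less[OF this] have "radix_code (\<sigma> + 1) (map f [0..<Suc j]) < (\<sigma> + 1) ^ Suc j" by simp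
  also have "\<dots> \<le> (\<sigma> + 1) ^ L" using assms(2) by (intro power_increasing) auto
  finally show c: "radix_code (\<sigma> + 1) (map f [0..<Suc j]) \<le> (n + \<sigma>) ^ 10" using bounds(7) by linarith
  have e: "radix_code (\<sigma> + 1) (map f [0..<Suc j]) = radix_code (\<sigma> + 1) (map f [0..<j]) * (\<sigma> + 1) + f j" by simp
  show "take_bit w (radix_code (\<sigma> + 1) (map f [0..<j]) * (\<sigma> + 1)) = radix_code (\<sigma> + 1) (map f [0..<j]) * (\<sigma> + 1)"
    by (rule word_small) (use c e in linarith)
  show "take_bit w (radix_code (\<sigma> + 1) (map f [0..<j]) * (\<sigma> + 1) + f j) = radix_code (\<sigma> + 1) (map f [0..<Suc j])"
    unfolding e[symmetric] by (rule word_small) (use c in linarith)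
qed

lemma w_pos: "0 < w"
  using word_small[of 1] bounds(3,4) by (cases w) auto

lemma wp_store_pattern:
  assumes x: "x \<in> patterns \<sigma> m" and s: "env s" "reg s 10 = 0" "mem s = (\<lambda>_. 0)" "used s = 0"
    and post: "\<And>k' s'. env s' \<Longrightarrow> mem s' = table \<sigma> x 0 \<Longrightarrow> used s' \<le> M + m \<Longrightarrow>
      k' \<le> k + 1 + 5 * m \<Longrightarrow> Q k' s'"
  shows "wp w x store_pattern Q k s"
proof -
  have lx: "length x = m" and sx: "\<And>j. j < m \<Longrightarrow> x ! j < \<sigma>"
    using x by (auto simp: patterns_def subset_iff)
  define mm where "mm i a = (if M \<le> a \<and> a < M + i then x ! (a - M) else 0)" for i a
  define I where "I i s \<longleftrightarrow> env s \<and> reg s 10 = i \<and> mem s = mm i \<and> used s \<le> M + m" for i s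
  show ?thesis unfolding store_pattern_def
  proof (rule wp_while[where I = I and N = m and T = "\<lambda>_. 4"])
    fix i s assume i: "i < m" and I: "I i s"
    have tb: "take_bit w (Suc i) = Suc i" "take_bit w (M + i) = M + i" "take_bit w (x ! i) = x ! i"
      using bounds i sx[OF i] by (intro word_small; linarith)+
    have "(mm i)(M + i := x ! i) = mm (Suc i)" by (auto simp: mm_def fun_eq_iff)
    with tb show "wp w x (block [Read 11 10, Arith Add 12 6 10, Store 12 11, Arith Add 10 10 3])
        (\<lambda>k s. I (Suc i) s \<and> k \<le> 4) 0 s"
      by (intro wp_rules) (use I i in \<open>simp_all add: I_def env_def lx\<close>)
  next
    fix k' s' assume "I m s'" "k' \<le> k + Suc (\<Sum>i<m. Suc 4)"
    moreover have "mm m = table \<sigma> x 0" by (auto simp: mm_def table_def fun_eq_iff lx)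
    ultimately show "Q k' s'" by (intro post) (auto simp: I_def)
  qed (use s in \<open>auto simp: I_def env_def mm_def\<close>)
qed

lemma wp_gram_code:
  assumes x: "x \<in> patterns \<sigma> m" and q: "q < D * 2 ^ L"
    and s: "env s" "reg s 10 = q div 2 ^ L" "reg s 13 = D * 2 ^ L" "reg s 14 = q" "reg s 15 = 0" "reg s 16 = 0"
    and post: "\<And>k' s'. env s' \<Longrightarrow> reg s' 13 = D * 2 ^ L \<Longrightarrow> reg s' 14 = q \<Longrightarrow>
      reg s' 15 = radix_code (\<sigma> + 1) (map (gram \<sigma> x q) [0..<L]) \<Longrightarrow> mem s' = mem s \<Longrightarrow> used s' = used s \<Longrightarrow>
      k' \<le> k + 1 + 10 * L \<Longrightarrow> Q k' s'"
  shows "wp w x gram_code Q k s"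
proof -
  have lx: "length x = m" and sx: "\<And>j. j < m \<Longrightarrow> x ! j < \<sigma>"
    using x by (auto simp: patterns_def subset_iff)
  define I where "I j s' \<longleftrightarrow> env s' \<and> reg s' 10 = q div 2 ^ L \<and> reg s' 13 = D * 2 ^ L \<and> reg s' 14 = q \<and>
    reg s' 15 = radix_code (\<sigma> + 1) (map (gram \<sigma> x q) [0..<j]) \<and> reg s' 16 = j \<and> mem s' = mem s \<and> used s' = used s"
    for j and s' :: ram
  have qD: "q div 2 ^ L < D" using q by (simp add: less_mult_imp_div_less)
  have pos: "q div 2 ^ L + j < m" if "j < L" for j using that qD gram_length_le by linarith
  show ?thesis unfolding gram_code_def
  proof (rule wp_while[where I = I and N = L and T = "\<lambda>_. 9"])
    fix j s' assume j: "j < L" and I: "I j s'"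
    let ?p = "q div 2 ^ L + j"
    have tb: "take_bit w (Suc j) = Suc j" "take_bit w ?p = ?p" "take_bit w (x ! ?p) = x ! ?p"
      "take_bit w \<sigma> = \<sigma>"
      using bounds j sx[OF pos[OF j]] pos[OF j] by (intro word_small; linarith)+
    have b: "drop_bit j q mod 2 = of_bool (bit q j)"
      by (simp add: bit_iff_odd_drop_bit mod_2_eq_odd)
    have g: "gram \<sigma> x q j = (if bit q j then \<sigma> else x ! ?p)" by (simp add: gram_def lx)
    have "gram \<sigma> x q i \<le> \<sigma>" if "i \<le> j" for i
      using sx[OF pos[of i]] that j by (auto simp: gram_def lx)
    note c = radix_code_step_small[where f = "gram \<sigma> x q", OF this j]
    show "wp w x (Seq (block [Arith Add 18 10 16, Read 18 18, Arith Shr 19 14 16, Arith And 19 19 3])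
     (Seq (IfLess 20 19 (Instr (Arith Add 18 0 20)) (Instr (Const 8 0)))
       (block [Arith Mul 15 15 4, Arith Add 15 15 18, Arith Add 16 16 3])))
      (\<lambda>k s'. I (Suc j) s' \<and> k \<le> 9) 0 s'"
      by (intro wp_rules)
        (use I c pos[OF j] in \<open>simp_all add: I_def env_def tb b g lx del: upt_Suc\<close>)
  qed (use s in \<open>simp_all add: I_def env_def post\<close>)
qed

text \<open>The memory is zero at the start, so the table need not be cleared, and the running time
  is linear in the table size.\<close>

lemma wp_preprocessing:
  assumes x: "x \<in> patterns \<sigma> m"
  shows "wp w x preprocessing (\<lambda>k s. mem s = table \<sigma> x (D * 2 ^ L) \<and> used s \<le> M + m \<and> k \<le> 70 * M)
    0 (start w [\<sigma>, length x] (\<lambda>_. 0) 0)"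
proof -
  have lx: "length x = m" using x by (auto simp: patterns_def)
  have st: "take_bit w \<sigma> = \<sigma>" "take_bit w m = m" "take_bit w (D * 2 ^ L) = D * 2 ^ L"
    using bounds mask_count_bound by (intro word_small; linarith)+
  define N where "N = D * 2 ^ L"
  have N: "take_bit w (push_bit L (Suc (m - L))) = N"
    using st(3) by (simp add: N_def push_bit_eq_mult)
  define I where "I q s \<longleftrightarrow> env s \<and> reg s 13 = N \<and> reg s 14 = q \<and> mem s = table \<sigma> x q \<and> used s \<le> M + m"
    for q s
  \<comment> \<open>Marking has at most \<open>2 * m * 2 ^ l\<close> rounds of cost at most
    \<open>18 * m\<close>, where \<open>l\<close> is \<open>min_gram_length\<close>. The product
    \<open>36 * m ^ 2 * 2 ^ l\<close> is at most \<open>36 * M\<close>, and the remaining terms fit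
    generously into \<open>70 * M\<close>.\<close>
  have time: "12 + 4 * min_gram_length \<sigma> m + 1 + (1 + 5 * m) + 2 + Suc (\<Sum>i<N. Suc (7 + 10 * L)) \<le> 70 * M"
  proof -
    have "min_gram_length \<sigma> m \<le> 2 ^ min_gram_length \<sigma> m" using less_exp less_imp_le by blast
    also have "\<dots> \<le> m ^ 3 * 2 ^ min_gram_length \<sigma> m" using m by simp
    finally have l: "min_gram_length \<sigma> m \<le> M" by (simp add: table_size_def)
    have LL: "(2::nat) ^ L \<le> 2 ^ min_gram_length \<sigma> m" by (intro power_increasing) (auto simp: gram_length_def)
    have "D \<le> 2 * m" using m by simp
    then have "N \<le> 2 * m * 2 ^ min_gram_length \<sigma> m" unfolding N_def using LL by (intro mult_mono) auto
    moreover have "8 + 10 * L \<le> 18 * m" using gram_length_le m by simp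
    ultimately have "N * (8 + 10 * L) \<le> (2 * m * 2 ^ min_gram_length \<sigma> m) * (18 * m)" by (rule mult_mono) auto
    also have "\<dots> = 36 * (m ^ 2 * 2 ^ min_gram_length \<sigma> m)" by (simp add: power2_eq_square)
    also have "m ^ 2 * 2 ^ min_gram_length \<sigma> m \<le> M" unfolding table_size_def
      using m by (intro mult_right_mono power_increasing) auto
    finally have "N * (8 + 10 * L) \<le> 36 * M" by simp
    moreover have "1 \<le> M" using table_size_pos by simp
    ultimately show ?thesis using l table_size_ge by simp
  qed
  have loop: "wp w x mark_grams (\<lambda>k s. mem s = table \<sigma> x N \<and> used s \<le> M + m \<and> k \<le> 70 * M) k s"
    if "I 0 s" "k \<le> 12 + 4 * min_gram_length \<sigma> m + 1 + (1 + 5 * m) + 2" for k s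
    unfolding mark_grams_def
  proof (rule wp_while[where I = I and N = N and T = "\<lambda>_. 7 + 10 * L"])
    fix q s assume q: "q < N" and I: "I q s"
    have tb: "take_bit w (Suc q) = Suc q"
      using q mask_count_bound by (intro word_small) (simp add: N_def)
    define c where "c = radix_code (\<sigma> + 1) (map (gram \<sigma> x q) [0..<L])"
    have cM: "c mod M < M" using table_size_pos by simp
    have "gram_index \<sigma> x q = c mod M" by (simp add: c_def gram_index_def lx)
    then have t: "(table \<sigma> x q)(c mod M := Suc 0) = table \<sigma> x (Suc q)"
      by (auto simp: table_def fun_eq_iff lessThan_Suc)
    have fin: "wp w x (block [Arith Mod 15 15 6, Store 15 3, Arith Add 14 14 3])
        (\<lambda>k s. I (Suc q) s \<and> k \<le> 7 + 10 * L) k s'"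
      if "env s'" "reg s' 13 = N" "reg s' 14 = q" "reg s' 15 = c" "mem s' = mem s" "used s' = used s"
        "k \<le> 3 + 1 + 10 * L" for k s'
      by (intro wp_rules) (use that I tb t cM in \<open>simp_all add: I_def env_def\<close>)
    show "wp w x (Seq (block [Arith Shr 10 14 5, Const 15 0, Const 16 0])
     (Seq gram_code (block [Arith Mod 15 15 6, Store 15 3, Arith Add 14 14 3])))
      (\<lambda>k s. I (Suc q) s \<and> k \<le> 7 + 10 * L) 0 s"
      by (intro wp_rules wp_gram_code[OF x q[unfolded N_def]] fin)
        (use I in \<open>simp_all add: I_def env_def drop_bit_eq_div N_def c_def\<close>)
  qed (use that time in \<open>auto simp: I_def\<close>)
  show ?thesis unfolding preprocessing_def N_def[symmetric]
    by (intro wp_rules wp_params wp_store_pattern[OF x] loop)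
      (simp_all add: start_def lx st(1,2) I_def env_def N w_pos)
qed

end

subsection \<open>Search\<close>

text \<open>The machine tests only strict inequality. A text character below the pattern character
  is a letter and hence a mismatch; one above it is a mismatch unless it equals
  \<open>\<sigma>\<close>, the wildcard. Register \<open>19\<close> is the mismatch flag.\<close>

definition compare :: com where
  "compare = WhileLess 18 1 (Seq (block [Arith Add 21 11 18, Read 21 21, Arith Add 22 6 18, Load 22 22])
     (Seq (IfLess 21 22 (Instr (Const 19 1))
        (IfLess 22 21 (IfLess 21 0 (Instr (Const 19 1)) (Instr (Const 8 0))) (Instr (Const 8 0))))
       (block [Arith Add 18 18 3])))"

definition verify :: com where
  "verify = WhileLess 11 17 (Seq (block [Const 18 0, Const 19 0]) (Seq compare
     (Seq (IfLess 19 3 (Instr (Output 11)) (Instr (Const 8 0))) (block [Arith Add 11 11 3]))))"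

definition text_code :: com where
  "text_code = WhileLess 13 5
     (block [Arith Add 15 14 13, Read 15 15, Arith Mul 12 12 4, Arith Add 12 12 15, Arith Add 13 13 3])"

definition verify_if_hit :: com where
  "verify_if_hit = Seq (IfLess 20 12 verify (Instr (Const 8 0))) (block [Arith Add 11 16 20])"

text \<open>A round settles the \<open>D = m - L + 1\<close> candidate starts from \<open>a\<close>
  to \<open>a + D - 1\<close>, with \<open>a\<close> in register \<open>11\<close>. The windows at
  all of them contain the \<open>L\<close> characters from \<open>a + m - L\<close> to
  \<open>a + m - 1\<close>, so one table lookup may dismiss them together. Register
  \<open>17\<close> holds the end of the group, clipped to the last possible start.\<close>

definition windows :: com where
  "windows = WhileLess 11 10
     (Seq (block [Const 12 0, Const 13 0, Arith Add 14 11 1, Arith Sub 14 14 5]) (Seq text_code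
     (Seq (block [Arith Mod 12 12 6, Load 12 12, Arith Add 16 11 9, Arith Add 17 16 20])
     (Seq (IfLess 10 17 (block [Arith Add 17 10 20]) (Instr (Const 8 0))) verify_if_hit))))"

definition searching :: com where
  "searching = Seq params (Seq (block [Arith Sub 10 2 1, Arith Add 10 10 3, Const 11 0]) windows)"

definition hit :: "nat \<Rightarrow> nat list \<Rightarrow> nat option list \<Rightarrow> nat \<Rightarrow> bool" where
  "hit \<sigma> x t p \<longleftrightarrow> radix_code (\<sigma> + 1) (map (\<lambda>j. encode \<sigma> (t ! (p + j))) [0..<gram_length \<sigma> (length x)]) mod table_size \<sigma> (length x)
     \<in> gram_index \<sigma> x ` {..<(length x - gram_length \<sigma> (length x) + 1) * 2 ^ gram_length \<sigma> (length x)}"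

text \<open>A factor of an occurrence is a gram whose mask records the wildcards of the text.\<close>
lemma occurrence_hit:
  assumes "i \<in> occurrences x t" "set x \<subseteq> {..<\<sigma>}" "i \<le> p" "p + gram_length \<sigma> (length x) \<le> i + length x"
  shows "hit \<sigma> x t p"
proof -
  define l where "l = gram_length \<sigma> (length x)"
  \<comment> \<open>\<open>mask\<close> has bit \<open>j\<close> set where the block of the text has
    a wildcard. Together with the offset \<open>p - i\<close> of the factor in the pattern it forms
    the number \<open>q\<close> of the round that marks this block.\<close>
  define mask :: nat where "mask = horner_sum of_bool 2 (map (\<lambda>j. t ! (p + j) = None) [0..<l])"
  define q where "q = (p - i) * 2 ^ l + mask"
  have mask: "mask < (2::nat) ^ l" using horner_sum_of_bool_2_less[of "map (\<lambda>j. t ! (p + j) = None) [0..<l]"]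
    by (simp add: mask_def)
  have "q < (p - i) * 2 ^ l + 2 ^ l" using mask by (simp add: q_def)
  also have "\<dots> = (p - i + 1) * 2 ^ l" by simp
  also have "\<dots> \<le> (length x - l + 1) * 2 ^ l" using assms(3,4) by (intro mult_right_mono) (auto simp: l_def)
  finally have q: "q < (length x - l + 1) * 2 ^ l" .
  have qdiv: "q div 2 ^ l = p - i" using mask by (simp add: q_def)
  have bit: "bit q j \<longleftrightarrow> t ! (p + j) = None" if "j < l" for j
  proof -
    have "take_bit l q = mask" using mask by (simp add: q_def take_bit_eq_mod)
    then have "bit q j \<longleftrightarrow> bit mask j" using that by (metis bit_take_bit_iff)
    also have "\<dots> \<longleftrightarrow> t ! (p + j) = None" using that
      by (simp add: mask_def bit_horner_sum_bit_iff)
    finally show ?thesis .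
  qed
  have "gram \<sigma> x q j = encode \<sigma> (t ! (p + j))" if "j < l" for j
  proof -
    have "p - i + j < length x" using that assms(3,4) by (simp add: l_def)
    with assms(1) have "t ! (i + (p - i + j)) = None \<or> t ! (i + (p - i + j)) = Some (x ! (p - i + j))"
      by (auto simp: mem_occurrences_iff)
    then have "t ! (p + j) = None \<or> t ! (p + j) = Some (x ! (p - i + j))"
      using assms(3) by simp
    then show ?thesis using bit[OF that] qdiv
      by (auto simp: gram_def encode_def l_def[symmetric])
  qed
  then have e: "map (gram \<sigma> x q) [0..<l] = map (\<lambda>j. encode \<sigma> (t ! (p + j))) [0..<l]" by simp
  have "radix_code (\<sigma> + 1) (map (\<lambda>j. encode \<sigma> (t ! (p + j))) [0..<l]) mod table_size \<sigma> (length x) = gram_index \<sigma> x q"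
    by (simp only: gram_index_def l_def[symmetric] e)
  with q show ?thesis unfolding hit_def l_def by blast
qed

text \<open>Needed for the last group of candidates, which may be clipped at the end
  \<open>e\<close> of the possible starts.\<close>

lemma Int_lessThan_Un_min:
  fixes a :: nat
  assumes "A \<subseteq> {..<e}" "a \<le> b"
  shows "(A \<inter> {..<a}) \<union> (A \<inter> {a..<min b e}) = A \<inter> {..<b}"
proof -
  have "A \<inter> {a..<min b e} = A \<inter> {a..<b}" using assms(1) by fastforce
  moreover have "{..<a} \<union> {a..<b} = {..<b}" using assms(2) by (rule ivl_disj_un)
  ultimately show ?thesis by blast
qed

lemma encode_text_le: "t \<in> texts \<sigma> n \<Longrightarrow> i < n \<Longrightarrow> encode \<sigma> (t ! i) \<le> \<sigma>"
proof -
  assume t: "t \<in> texts \<sigma> n" "i < n"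
  then have "t ! i \<in> text_alphabet \<sigma>" by (auto simp: texts_def)
  then show ?thesis by (auto simp: text_alphabet_def encode_def)
qed

context word_size begin

text \<open>The quotient \<open>(n - m + 1) / D\<close> rounded up: there are
  \<open>n - m + 1\<close> possible starts, and a round settles \<open>D\<close> of them.\<close>

definition windows_count :: nat where
  "windows_count = (n - m + D) div D"

lemma windows_count_iff: "j * D < n - m + 1 \<longleftrightarrow> j < windows_count"
proof -
  have "windows_count = (n - m) div D + 1"
    unfolding windows_count_def by (rule div_add_self2) simp
  then show ?thesis using less_eq_div_iff_mult_less_eq[of D j "n - m"] by (simp add: less_Suc_eq_le)
qed

end

locale search_instance = word_size +
  fixes x t
  assumes x: "x \<in> patterns \<sigma> m" and t: "t \<in> texts \<sigma> n"
begin

lemma lx: "length x = m" and sx: "j < m \<Longrightarrow> x ! j < \<sigma>"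
  and lt: "length t = n"
  using x t by (auto simp: patterns_def texts_def subset_iff)

abbreviation "inp \<equiv> map (encode \<sigma>) t"

definition ptable :: "nat \<Rightarrow> nat" where
  "ptable = table \<sigma> x (D * 2 ^ L)"

definition senv :: "ram \<Rightarrow> bool" where
  "senv s \<longleftrightarrow> env s \<and> reg s 10 = n - m + 1 \<and> mem s = ptable \<and> used s \<le> M + m"

lemma gram_index_less: "gram_index \<sigma> x q < M"
  using table_size_pos by (simp add: gram_index_def lx)

lemma ptable_pattern: "j < m \<Longrightarrow> ptable (M + j) = x ! j"
  using gram_index_less by (auto simp: ptable_def table_def lx) (metis le_add1 less_le_not_le)

lemma wp_compare:
  assumes s: "senv s" "reg s 11 = i" "i \<le> n - m" "reg s 18 = 0" "reg s 19 = 0"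
    and post: "\<And>k' s'. senv s' \<Longrightarrow> reg s' 11 = i \<Longrightarrow> reg s' 16 = reg s 16 \<Longrightarrow> reg s' 17 = reg s 17 \<Longrightarrow>
      out s' = out s \<Longrightarrow> reg s' 19 = of_bool (i \<notin> occurrences x t) \<Longrightarrow> k' \<le> k + 1 + 10 * m \<Longrightarrow> Q k' s'"
  shows "wp w inp compare Q k s"
proof -
  define bad where "bad r \<longleftrightarrow> (\<exists>j<r. \<not> (t ! (i + j) = None \<or> t ! (i + j) = Some (x ! j)))" for r
  define I where "I r s' \<longleftrightarrow> senv s' \<and> reg s' 11 = i \<and> reg s' 16 = reg s 16 \<and> reg s' 17 = reg s 17 \<and>
    out s' = out s \<and> reg s' 18 = r \<and> reg s' 19 = of_bool (bad r)" for r s'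
  show ?thesis unfolding compare_def
  proof (rule wp_while[where I = I and N = m and T = "\<lambda>_. 9"])
    fix r s' assume r: "r < m" and I: "I r s'"
    have ir: "i + r < n" using r s mn by linarith
    define e where "e = encode \<sigma> (t ! (i + r))"
    have e: "e \<le> \<sigma>" unfolding e_def by (rule encode_text_le[OF t ir])
    have tb: "take_bit w (Suc r) = Suc r" "take_bit w (i + r) = i + r" "take_bit w (M + r) = M + r"
      "take_bit w e = e" "take_bit w (Suc 0) = Suc 0"
      using bounds r ir e by (intro word_small; linarith)+
    have ie: "inp ! (i + r) = e" using ir by (simp add: e_def lt)
    have "t ! (i + r) \<in> text_alphabet \<sigma>" using t ir by (auto simp: texts_def)
    then have b: "bad (Suc r) \<longleftrightarrow> bad r \<or> e < x ! r \<or> (x ! r < e \<and> e < \<sigma>)"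
      using sx[OF r] by (auto simp: bad_def e_def encode_def less_Suc_eq text_alphabet_def)
    show "wp w inp (Seq (block [Arith Add 21 11 18, Read 21 21, Arith Add 22 6 18, Load 22 22])
     (Seq (IfLess 21 22 (Instr (Const 19 1))
        (IfLess 22 21 (IfLess 21 0 (Instr (Const 19 1)) (Instr (Const 8 0))) (Instr (Const 8 0))))
       (block [Arith Add 18 18 3]))) (\<lambda>k s'. I (Suc r) s' \<and> k \<le> 9) 0 s'"
      by (intro wp_rules)
        (use I ir r in \<open>simp_all add: I_def senv_def env_def tb ie lt ptable_pattern b w_pos\<close>)
  next
    fix k' s' assume I: "I m s'" and k': "k' \<le> k + Suc (\<Sum>i<m. Suc 9)"
    have "bad m \<longleftrightarrow> i \<notin> occurrences x t"
      using s(3) mn by (auto simp: bad_def mem_occurrences_iff lx lt)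
    with I k' show "Q k' s'" by (intro post) (simp_all add: I_def)
  qed (use s in \<open>simp_all add: I_def senv_def env_def bad_def\<close>)
qed

lemma wp_verify:
  assumes s: "senv s" "reg s 11 = a" "reg s 17 = b" "a \<le> b" "b \<le> n - m + 1"
    and post: "\<And>k' s'. senv s' \<Longrightarrow> reg s' 16 = reg s 16 \<Longrightarrow>
      set (out s') = set (out s) \<union> (occurrences x t \<inter> {a..<b}) \<Longrightarrow>
      k' \<le> k + 1 + (b - a) * (7 + 10 * m) \<Longrightarrow> Q k' s'"
  shows "wp w inp verify Q k s"
proof -
  define I where "I r s' \<longleftrightarrow> senv s' \<and> reg s' 11 = a + r \<and> reg s' 16 = reg s 16 \<and> reg s' 17 = b \<and>
    set (out s') = set (out s) \<union> (occurrences x t \<inter> {a..<a + r})" for r s'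
  show ?thesis unfolding verify_def
  proof (rule wp_while[where I = I and N = "b - a" and T = "\<lambda>_. 6 + 10 * m"])
    fix r s' assume r: "r < b - a" and I: "I r s'"
    have i: "a + r \<le> n - m" using r s by linarith
    have tb: "take_bit w (Suc (a + r)) = Suc (a + r)"
      using bounds i mn by (intro word_small) linarith
    have fin: "wp w inp (Seq (IfLess 19 3 (Instr (Output 11)) (Instr (Const 8 0))) (block [Arith Add 11 11 3]))
      (\<lambda>k s'. I (Suc r) s' \<and> k \<le> 6 + 10 * m) k s''"
      if "senv s''" "reg s'' 11 = a + r" "reg s'' 16 = reg s 16" "reg s'' 17 = b" "out s'' = out s'"
        "reg s'' 19 = of_bool (a + r \<notin> occurrences x t)" "k \<le> 2 + 1 + 10 * m" for k s''
    proof -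
      have "{a..<Suc (a + r)} = insert (a + r) {a..<a + r}" by auto
      then show ?thesis
        by (intro wp_rules) (use that I tb in \<open>auto simp: I_def senv_def env_def\<close>)
    qed
    show "wp w inp (Seq (block [Const 18 0, Const 19 0]) (Seq compare
     (Seq (IfLess 19 3 (Instr (Output 11)) (Instr (Const 8 0))) (block [Arith Add 11 11 3]))))
      (\<lambda>k s'. I (Suc r) s' \<and> k \<le> 6 + 10 * m) 0 s'"
      by (intro wp_rules wp_compare[where i = "a + r"] fin)
        (use I i in \<open>simp_all add: I_def senv_def env_def\<close>)
  qed (use s in \<open>simp_all add: I_def senv_def env_def post less_diff_conv\<close>, linarith?)
qed

lemma wp_text_code:
  assumes s: "senv s" "reg s 14 = p" "p + L \<le> n" "reg s 12 = 0" "reg s 13 = 0"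
    and post: "\<And>k' s'. senv s' \<Longrightarrow> reg s' 11 = reg s 11 \<Longrightarrow> out s' = out s \<Longrightarrow>
      reg s' 12 = radix_code (\<sigma> + 1) (map (\<lambda>j. encode \<sigma> (t ! (p + j))) [0..<L]) \<Longrightarrow>
      k' \<le> k + 1 + 6 * L \<Longrightarrow> Q k' s'"
  shows "wp w inp text_code Q k s"
proof -
  define f where "f j = encode \<sigma> (t ! (p + j))" for j
  define I where "I j s' \<longleftrightarrow> senv s' \<and> reg s' 11 = reg s 11 \<and> out s' = out s \<and> reg s' 14 = p \<and>
    reg s' 13 = j \<and> reg s' 12 = radix_code (\<sigma> + 1) (map f [0..<j])" for j s'
  have fle: "f j \<le> \<sigma>" if "j < L" for j
    unfolding f_def using s(3) that by (intro encode_text_le[OF t]) simp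
  show ?thesis unfolding text_code_def
  proof (rule wp_while[where I = I and N = L and T = "\<lambda>_. 5"])
    fix j s' assume j: "j < L" and I: "I j s'"
    have pj: "p + j < n" using j s(3) by simp
    have tb: "take_bit w (Suc j) = Suc j" "take_bit w (p + j) = p + j" "take_bit w (f j) = f j"
      using bounds j pj fle[OF j] by (intro word_small; linarith)+
    have i: "inp ! (p + j) = f j" using pj by (simp add: f_def lt)
    have "f i \<le> \<sigma>" if "i \<le> j" for i using fle that j by simp
    note c = radix_code_step_small[where f = f, OF this j]
    show "wp w inp (block [Arith Add 15 14 13, Read 15 15, Arith Mul 12 12 4, Arith Add 12 12 15, Arith Add 13 13 3])
      (\<lambda>k s'. I (Suc j) s' \<and> k \<le> 5) 0 s'"
      by (intro wp_rules) (use I pj c in \<open>simp_all add: I_def senv_def env_def tb i lt del: upt_Suc\<close>)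
  qed (use s in \<open>simp_all add: I_def senv_def env_def post f_def[abs_def]\<close>)
qed

text \<open>Either way the candidates of the group are settled: on a hit they are compared one by
  one, and otherwise \<open>occurrence_hit\<close> excludes all of them. Only a hit costs more than
  constant time.\<close>

lemma wp_verify_if_hit:
  assumes s: "senv s" "reg s 11 = a" "reg s 12 = of_bool (hit \<sigma> x t (a + m - L))" "reg s 16 = a + D"
    "reg s 17 = min (a + D) (n - m + 1)" "a \<le> n - m" "set (out s) = occurrences x t \<inter> {..<a}"
    and post: "\<And>k' s'. senv s' \<Longrightarrow> reg s' 11 = a + D \<Longrightarrow> set (out s') = occurrences x t \<inter> {..<a + D} \<Longrightarrow>
      k' \<le> k + 3 + (if hit \<sigma> x t (a + m - L) then D * (7 + 10 * m) else 0) \<Longrightarrow> Q k' s'"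
  shows "wp w inp verify_if_hit Q k s"
proof -
  have tb: "take_bit w (Suc (a + (m - L))) = Suc (a + (m - L))"
    using bounds s(6) mn by (intro word_small) linarith
  have occ: "occurrences x t \<subseteq> {..<n - m + 1}"
    by (auto simp: mem_occurrences_iff lx lt)
  show ?thesis
  proof (cases "hit \<sigma> x t (a + m - L)")
    case True
    define b where "b = min (a + D) (n - m + 1)"
    have b: "reg s 17 = b" "a \<le> b" "b \<le> n - m + 1" "b - a \<le> D" using s(5,6) by (auto simp: b_def)
    define u where "u = (b - a) * (7 + 10 * m)"
    have u: "u \<le> D * (7 + 10 * m)" unfolding u_def using b(4) by (rule mult_right_mono) simp
    have fin: "wp w inp (block [Arith Add 11 16 20]) Q k' s'"
      if "senv s'" "reg s' 16 = reg s 16" "set (out s') = set (out s) \<union> (occurrences x t \<inter> {a..<b})"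
        "k' \<le> Suc k + 1 + u" for k' s'
    proof (intro wp_rules post)
      have "set (out s') = occurrences x t \<inter> {..<a + D}"
        unfolding that(3) s(7) b_def by (rule Int_lessThan_Un_min[OF occ]) simp
      then show "set (out (fold (step w inp) [Arith Add 11 16 20] s')) = occurrences x t \<inter> {..<a + D}" by simp
      have "k' + 1 \<le> k + 3 + D * (7 + 10 * m)" using that(4) u by linarith
      then show "k' + length [Arith Add 11 16 20] \<le> k + 3 + (if hit \<sigma> x t (a + m - L) then D * (7 + 10 * m) else 0)"
        by (simp only: True if_True list.size add_0 One_nat_def)
    qed (use that s(4) tb in \<open>simp_all add: senv_def env_def\<close>)
    show ?thesis unfolding verify_if_hit_def
    proof (rule wp_seq, rule wp_if, rule wp_verify)
      show "senv s" "reg s 11 = a" "reg s 17 = b" "a \<le> b" "b \<le> n - m + 1"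
        by (rule s(1) s(2) b(1) b(2) b(3))+
    next
      fix k' s' assume "senv s'" "reg s' 16 = reg s 16"
        "set (out s') = set (out s) \<union> (occurrences x t \<inter> {a..<b})" "k' \<le> Suc k + 1 + (b - a) * (7 + 10 * m)"
      then show "wp w inp (block [Arith Add 11 16 20]) Q k' s'" by (intro fin) (simp_all add: u_def)
    qed (use True s(1,3) in \<open>simp_all add: senv_def env_def\<close>)
  next
    case False
    have "i \<notin> occurrences x t" if "a \<le> i" "i < a + D" for i
    proof
      assume "i \<in> occurrences x t"
      then have "hit \<sigma> x t (a + m - L)"
        by (rule occurrence_hit) (use x that gram_length_le in \<open>auto simp: patterns_def\<close>)
      with False show False ..
    qed
    then have "occurrences x t \<inter> {..<a + D} = occurrences x t \<inter> {..<a}"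
      using not_le by (auto simp del: One_nat_def add_Suc_right)
    then show ?thesis unfolding verify_if_hit_def
      by (intro wp_rules post) (use False s(1,3,4,7) tb in \<open>simp_all add: senv_def env_def\<close>)
  qed
qed

text \<open>The time bound depends on the text only through the rounds that hit, which is the form
  in which expectations are taken later.\<close>

lemma wp_searching:
  "wp w inp searching (\<lambda>k s. set (out s) = occurrences x t \<and> used s \<le> M + m \<and>
     k \<le> 16 + 4 * min_gram_length \<sigma> m + (\<Sum>j<windows_count. 15 + 6 * L +
       (if hit \<sigma> x t (j * D + m - L) then D * (7 + 10 * m) else 0)))
   0 (start w [\<sigma>, length x, length t] ptable u)"
  if u: "u \<le> M + m" for u
proof -
  define T where "T j = 14 + 6 * L + (if hit \<sigma> x t (j * D + m - L) then D * (7 + 10 * m) else 0)" for j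
  define I where "I j s \<longleftrightarrow> senv s \<and> reg s 11 = j * D \<and> set (out s) = occurrences x t \<inter> {..<j * D}" for j s
  have loop: "wp w inp windows (\<lambda>k s. set (out s) = occurrences x t \<and> used s \<le> M + m \<and>
     k \<le> 16 + 4 * min_gram_length \<sigma> m + (\<Sum>j<windows_count. Suc (T j))) k s"
    if "I 0 s" "k \<le> 12 + 4 * min_gram_length \<sigma> m + 3" for k s
    unfolding windows_def
  proof (rule wp_while[where I = I and N = windows_count and T = T])
    fix j s assume "j < windows_count" and I: "I j s"
    define a where "a = j * D"
    have a: "a \<le> n - m" using windows_count_iff[of j] \<open>j < windows_count\<close> by (simp add: a_def)
    have Ij: "senv s" "reg s 11 = a" "set (out s) = occurrences x t \<inter> {..<a}"
      using I by (simp_all add: I_def a_def)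
    have IS: "I (Suc j) s' \<longleftrightarrow> senv s' \<and> reg s' 11 = a + D \<and> set (out s') = occurrences x t \<inter> {..<a + D}" for s'
      by (simp add: I_def a_def add_ac)
    have Tj: "T j = 14 + 6 * L + (if hit \<sigma> x t (a + m - L) then D * (7 + 10 * m) else 0)"
      by (simp add: T_def a_def)
    have tb: "take_bit w (a + m) = a + m" "take_bit w (Suc (a + (m - L))) = Suc (a + (m - L))"
      "take_bit w (Suc (a + m - L)) = Suc (a + m - L)"
      "take_bit w (Suc (n - m)) = Suc (n - m)"
      using bounds a mn by (intro word_small; linarith)+
    have sub: "take_bit w (a + m + 2 ^ w - L) = a + m - L"
      by (rule take_bit_sub) (use gram_length_le bounds a mn in \<open>auto intro!: word\<close>)
    define c where "c = radix_code (\<sigma> + 1) (map (\<lambda>j. encode \<sigma> (t ! (a + m - L + j))) [0..<L])"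
    have cM: "c mod M < M" using table_size_pos by simp
    then have tab: "ptable (c mod M) = of_bool (hit \<sigma> x t (a + m - L))"
      by (simp add: ptable_def table_def hit_def lx c_def)
    have fin: "wp w inp (Seq (block [Arith Mod 12 12 6, Load 12 12, Arith Add 16 11 9, Arith Add 17 16 20])
     (Seq (IfLess 10 17 (block [Arith Add 17 10 20]) (Instr (Const 8 0))) verify_if_hit))
       (\<lambda>k s'. I (Suc j) s' \<and> k \<le> T j) k s'"
      if "senv s'" "reg s' 11 = a" "out s' = out s" "reg s' 12 = c" "k \<le> 4 + 1 + 6 * L" for k s'
      by (intro wp_rules wp_verify_if_hit[where a = a])
        (use that Ij a cM in \<open>simp_all add: senv_def env_def tb tab IS Tj\<close>)
    show "wp w inp (Seq (block [Const 12 0, Const 13 0, Arith Add 14 11 1, Arith Sub 14 14 5]) (Seq text_code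
     (Seq (block [Arith Mod 12 12 6, Load 12 12, Arith Add 16 11 9, Arith Add 17 16 20])
     (Seq (IfLess 10 17 (block [Arith Add 17 10 20]) (Instr (Const 8 0))) verify_if_hit))))
       (\<lambda>k s. I (Suc j) s \<and> k \<le> T j) 0 s"
      by (intro wp_rules wp_text_code[where p = "a + m - L"] fin)
        (use Ij a gram_length_le mn in \<open>simp_all add: senv_def env_def tb sub c_def\<close>)
  next
    fix j s assume "j \<le> windows_count" "I j s"
    then show "(reg s 11 < reg s 10) = (j < windows_count)"
      using windows_count_iff[of j] by (simp add: I_def senv_def)
  next
    fix k' s assume I: "I windows_count s" and k': "k' \<le> k + Suc (\<Sum>j<windows_count. Suc (T j))"
    \<comment> \<open>After the last round the processed prefix contains every possible
      start.\<close>
    have "n - m + 1 \<le> windows_count * D" using windows_count_iff[of windows_count] by simp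
    then have "occurrences x t \<subseteq> {..<windows_count * D}"
      by (auto simp: mem_occurrences_iff lx lt)
    then show "set (out s) = occurrences x t \<and> used s \<le> M + m \<and>
      k' \<le> 16 + 4 * min_gram_length \<sigma> m + (\<Sum>j<windows_count. Suc (T j))"
      using I k' that by (auto simp: I_def senv_def)
  qed (use that in auto)
  have st: "take_bit w \<sigma> = \<sigma>" "take_bit w m = m" "take_bit w n = n" "take_bit w (Suc (n - m)) = Suc (n - m)"
    using bounds mn by (intro word_small; linarith)+
  have sub: "take_bit w (n + 2 ^ w - m) = n - m"
    by (rule take_bit_sub) (use bounds mn in \<open>auto intro!: word\<close>)
  have "wp w inp searching (\<lambda>k s. set (out s) = occurrences x t \<and> used s \<le> M + m \<and>
     k \<le> 16 + 4 * min_gram_length \<sigma> m + (\<Sum>j<windows_count. Suc (T j)))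
     0 (start w [\<sigma>, length x, length t] ptable u)"
    unfolding searching_def
    by (intro wp_rules wp_params loop) (use u in \<open>simp_all add: start_def lx lt st sub I_def senv_def env_def\<close>)
  moreover have "Suc (T j) = 15 + 6 * L + (if hit \<sigma> x t (j * D + m - L) then D * (7 + 10 * m) else 0)" for j
    by (simp add: T_def)
  ultimately show ?thesis by (simp only:)
qed

end

subsection \<open>Expected running time\<close>

lemma replicate_pmf_Suc_map:
  "replicate_pmf (Suc n) p = bind_pmf p (\<lambda>x. map_pmf ((#) x) (replicate_pmf n p))"
  by (simp add: map_pmf_def)

text \<open>Together with the counterpart for \<open>drop\<close>: every block of a random text is
  itself a random text.\<close>

lemma map_take_replicate_pmf: "map_pmf (take l) (replicate_pmf (l + r) p) = replicate_pmf l p"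
proof (induction l)
  case 0
  show ?case by (simp add: map_pmf_const)
next
  case (Suc l)
  have "map_pmf (take (Suc l)) (replicate_pmf (Suc l + r) p) =
      bind_pmf p (\<lambda>x. map_pmf ((#) x) (map_pmf (take l) (replicate_pmf (l + r) p)))"
    unfolding add_Suc replicate_pmf_Suc_map by (simp add: map_bind_pmf map_pmf_comp)
  then show ?case unfolding replicate_pmf_Suc_map by (simp only: Suc)
qed

lemma map_drop_replicate_pmf: "map_pmf (drop k) (replicate_pmf (k + r) p) = replicate_pmf r p"
proof (induction k)
  case (Suc k)
  have "map_pmf (drop (Suc k)) (replicate_pmf (Suc k + r) p) =
      bind_pmf p (\<lambda>x. map_pmf (drop k) (replicate_pmf (k + r) p))"
    unfolding add_Suc replicate_pmf_Suc_map by (simp add: map_bind_pmf map_pmf_comp)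
  then show ?case by (simp add: Suc)
qed (simp add: map_pmf_ident)

lemma pmf_replicate_pmf_le:
  assumes "\<And>a. pmf p a \<le> b"
  shows "pmf (replicate_pmf l p) xs \<le> b ^ l"
proof (induction l arbitrary: xs)
  case (Suc l)
  have b: "0 \<le> b" by (rule order.trans[OF pmf_nonneg assms])
  have eq: "replicate_pmf (Suc l) p = map_pmf (\<lambda>(x, xs). x # xs) (pair_pmf p (replicate_pmf l p))"
    by (simp add: pair_pmf_def map_bind_pmf bind_return_pmf map_return_pmf)
  show ?case
  proof (cases xs)
    case Nil
    then have "xs \<notin> set_pmf (replicate_pmf (Suc l) p)" by (auto simp: eq)
    then have "pmf (replicate_pmf (Suc l) p) xs = 0" by (simp only: set_pmf_iff) simp
    then show ?thesis using b by (simp del: replicate_pmf.simps)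
  next
    case (Cons y ys)
    have "inj (\<lambda>(x :: 'a, xs). x # xs)" by (auto intro: injI)
    from pmf_map_inj'[OF this, of "pair_pmf p (replicate_pmf l p)" "(y, ys)"]
    have "pmf (replicate_pmf (Suc l) p) xs = pmf p y * pmf (replicate_pmf l p) ys"
      by (simp only: eq Cons prod.case pmf_pair)
    also have "\<dots> \<le> b * b ^ l" by (intro mult_mono assms Suc pmf_nonneg b)
    finally show ?thesis by simp
  qed
qed simp

text \<open>A number is determined by its residue and its quotient, and below \<open>N\<close> at
  most \<open>N div M + 1\<close> quotients occur.\<close>

lemma card_mod_mem:
  fixes M N :: nat
  assumes "finite G"
  shows "card {v. v < N \<and> v mod M \<in> G} \<le> card G * (N div M + 1)"
proof -
  have "inj_on (\<lambda>v. (v mod M, v div M)) {v. v < N \<and> v mod M \<in> G}"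
    by (rule inj_onI) (metis mod_mult_div_eq prod.inject)
  moreover have "(\<lambda>v. (v mod M, v div M)) ` {v. v < N \<and> v mod M \<in> G} \<subseteq> G \<times> {..N div M}"
    by (auto intro: div_le_mono)
  ultimately have "card {v. v < N \<and> v mod M \<in> G} \<le> card (G \<times> {..N div M})"
    by (rule card_inj_on_le) (use assms in simp)
  then show ?thesis by (simp add: card_cartesian_product)
qed

lemma encode_inj: "inj_on (encode \<sigma>) (text_alphabet \<sigma>)"
  by (auto simp: inj_on_def text_alphabet_def encode_def)

lemma encode_less: "a \<in> text_alphabet \<sigma> \<Longrightarrow> encode \<sigma> a < \<sigma> + 1"
  by (auto simp: text_alphabet_def encode_def)

lemma card_text_alphabet: "card (text_alphabet \<sigma>) = \<sigma> + 1"
  by (simp add: text_alphabet_def card_insert_if card_image image_iff)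

lemma pmf_text_alphabet_le: "pmf (pmf_of_set (text_alphabet \<sigma>)) a \<le> 1 / real (\<sigma> + 1)"
proof -
  have "text_alphabet \<sigma> \<noteq> {}" "finite (text_alphabet \<sigma>)" by (auto simp: text_alphabet_def)
  then show ?thesis by (simp add: card_text_alphabet indicator_def)
qed

text \<open>The block is uniform over \<open>(\<sigma> + 1) ^ l\<close> words with distinct codes
  below \<open>(\<sigma> + 1) ^ l\<close>, so it suffices to count the numbers in that range whose
  residue lies in \<open>G\<close>.\<close>

lemma prob_code_mod_le:
  assumes "p + l \<le> n" "finite G"
  shows "measure_pmf.prob (random_text \<sigma> n)
      {t. radix_code (\<sigma> + 1) (map (encode \<sigma>) (take l (drop p t))) mod M \<in> G}
    \<le> real (card G) * (real ((\<sigma> + 1) ^ l div M) + 1) / real (\<sigma> + 1) ^ l"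
proof -
  let ?u = "pmf_of_set (text_alphabet \<sigma>)"
  define c where "c g = radix_code (\<sigma> + 1) (map (encode \<sigma>) g)" for g
  define A where "A = {g \<in> texts \<sigma> l. c g mod M \<in> G}"
  have "map_pmf (\<lambda>t. take l (drop p t)) (random_text \<sigma> n) =
      map_pmf (take l) (map_pmf (drop p) (replicate_pmf (p + (l + (n - p - l))) ?u))"
    using assms(1) by (simp add: random_text_def map_pmf_comp)
  also have "\<dots> = random_text \<sigma> l"
    by (simp only: map_drop_replicate_pmf map_take_replicate_pmf random_text_def)
  finally have eq: "map_pmf (\<lambda>t. take l (drop p t)) (random_text \<sigma> n) = random_text \<sigma> l" .
  have "measure_pmf.prob (random_text \<sigma> n) {t. c (take l (drop p t)) mod M \<in> G}
      = measure_pmf.prob (random_text \<sigma> l) {g. c g mod M \<in> G}"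
    by (simp add: eq[symmetric] vimage_def)
  also have "\<dots> = measure_pmf.prob (random_text \<sigma> l) A"
    by (subst measure_Int_set_pmf[symmetric]) (auto simp: set_pmf_random_text A_def intro!: arg_cong2[where f = measure])
  also have "\<dots> = (\<Sum>g\<in>A. pmf (random_text \<sigma> l) g)"
    by (rule measure_measure_pmf_finite) (simp add: A_def)
  also have "\<dots> \<le> (\<Sum>g\<in>A. (1 / real (\<sigma> + 1)) ^ l)"
    unfolding random_text_def by (intro sum_mono pmf_replicate_pmf_le pmf_text_alphabet_le)
  also have "\<dots> = real (card A) / real (\<sigma> + 1) ^ l" by (simp add: power_one_over)
  finally have prob: "measure_pmf.prob (random_text \<sigma> n) {t. c (take l (drop p t)) mod M \<in> G}
      \<le> real (card A) / real (\<sigma> + 1) ^ l" .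
  have "card A \<le> card G * ((\<sigma> + 1) ^ l div M + 1)"
  proof -
    have bd: "set (map (encode \<sigma>) g) \<subseteq> {..<\<sigma> + 1}" if "g \<in> A" for g
      using that encode_less by (fastforce simp: A_def texts_def)
    have "inj_on c A"
    proof (rule inj_onI)
      fix g h assume gh: "g \<in> A" "h \<in> A" "c g = c h"
      have "map (encode \<sigma>) g = map (encode \<sigma>) h"
        by (rule radix_code_inj[where b = "\<sigma> + 1"]) (use gh bd in \<open>auto simp: c_def A_def texts_def\<close>)
      moreover have "inj_on (encode \<sigma>) (set g \<union> set h)"
        by (rule inj_on_subset[OF encode_inj]) (use gh in \<open>auto simp: A_def texts_def\<close>)
      ultimately show "g = h" by (rule map_inj_on)
    qed
    moreover have "c ` A \<subseteq> {v. v < (\<sigma> + 1) ^ l \<and> v mod M \<in> G}"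
    proof
      fix v assume "v \<in> c ` A"
      then obtain g where g: "g \<in> A" "v = c g" by blast
      with radix_code_less[OF bd[OF g(1)]] show "v \<in> {v. v < (\<sigma> + 1) ^ l \<and> v mod M \<in> G}"
        by (auto simp: c_def A_def texts_def)
    qed
    ultimately have "card A \<le> card {v. v < (\<sigma> + 1) ^ l \<and> v mod M \<in> G}"
      by (rule card_inj_on_le) simp
    then show ?thesis using card_mod_mem[OF assms(2), of "(\<sigma> + 1) ^ l" M] by linarith
  qed
  then have "real (card A) \<le> real (card G * ((\<sigma> + 1) ^ l div M + 1))" by (rule of_nat_mono)
  then have "real (card A) \<le> real (card G) * (real ((\<sigma> + 1) ^ l div M) + 1)"
    by (simp only: of_nat_mult of_nat_add of_nat_1)
  then have "real (card A) / real (\<sigma> + 1) ^ l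
      \<le> real (card G) * (real ((\<sigma> + 1) ^ l div M) + 1) / real (\<sigma> + 1) ^ l"
    by (rule divide_right_mono) simp
  with prob show ?thesis unfolding c_def by (rule order.trans)
qed

section \<open>Correctness, time and space of the algorithm\<close>

definition Wt :: algorithm where
  "Wt = (preprocessing, searching)"

context search_instance begin

lemma Wt_preprocess_run:
  obtains j s0 where "preprocess_run w Wt \<sigma> x j s0" "mem s0 = ptable" "used s0 \<le> M + m" "j \<le> 70 * M"
  using wp_preprocessing[OF x] unfolding wp_def preprocess_run_def Wt_def ptable_def by auto

lemma Wt_preprocess_time: "preprocess_time w Wt \<sigma> x \<le> 70 * M"
  using Wt_preprocess_run preprocess_time_eq by metis

lemma Wt_search_run:
  obtains k s where "search_run w Wt \<sigma> x t k s" "set (out s) = occurrences x t" "used s \<le> M + m"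
    "k \<le> 16 + 4 * min_gram_length \<sigma> m + (\<Sum>j<windows_count. 15 + 6 * L +
       (if hit \<sigma> x t (j * D + m - L) then D * (7 + 10 * m) else 0))"
proof -
  obtain j s0 where pre: "preprocess_run w Wt \<sigma> x j s0" "mem s0 = ptable" "used s0 \<le> M + m"
    using Wt_preprocess_run by blast
  from wp_searching[OF pre(3)] obtain k s where
    "exec w inp searching (start w [\<sigma>, length x, length t] ptable (used s0)) k s"
    "set (out s) = occurrences x t" "used s \<le> M + m"
    "k \<le> 16 + 4 * min_gram_length \<sigma> m + (\<Sum>j<windows_count. 15 + 6 * L +
       (if hit \<sigma> x t (j * D + m - L) then D * (7 + 10 * m) else 0))"
    unfolding wp_def by auto
  moreover from this(1) have "search_run w Wt \<sigma> x t k s"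
    unfolding search_run_def using pre(1,2)
    by (intro exI[of _ j] exI[of _ s0]) (simp add: Wt_def)
  ultimately show ?thesis using that by blast
qed

end

context word_size begin

lemma search_instanceI: "x \<in> patterns \<sigma> m \<Longrightarrow> t \<in> texts \<sigma> n \<Longrightarrow> search_instance \<sigma> m n w x t"
  by unfold_locales

lemma solves_Wt: "solves w Wt \<sigma> m n"
  unfolding solves_def using search_instance.Wt_search_run[OF search_instanceI] by metis

lemma space_used_Wt:
  assumes "x \<in> patterns \<sigma> m" "t \<in> texts \<sigma> n"
  shows "space_used w Wt \<sigma> x t \<le> 2 * M"
  using search_instance.Wt_search_run[OF search_instanceI[OF assms]] table_size_ge
  by (metis add_le_mono1 le_trans mult_2 nat_add_left_cancel_le space_used_eq)

lemma texts_nonempty: "\<exists>t. t \<in> texts \<sigma> n"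
  by (rule exI[of _ "replicate n None"]) (auto simp: texts_def text_alphabet_def)

lemma preprocess_time_Wt: "x \<in> patterns \<sigma> m \<Longrightarrow> preprocess_time w Wt \<sigma> x \<le> 70 * M"
  using search_instance.Wt_preprocess_time[OF search_instanceI] texts_nonempty by blast

lemma search_time_Wt:
  assumes "x \<in> patterns \<sigma> m" "t \<in> texts \<sigma> n"
  shows "search_time w Wt \<sigma> x t \<le> 16 + 4 * min_gram_length \<sigma> m + (\<Sum>j<windows_count. 15 + 6 * L +
       (if hit \<sigma> x t (j * D + m - L) then D * (7 + 10 * m) else 0))"
proof -
  interpret search_instance \<sigma> m n w x t by (rule search_instanceI[OF assms])
  show ?thesis using Wt_search_run search_time_eq by metis
qed

text \<open>At most \<open>m * 2 ^ L\<close> residues out of \<open>M = m ^ 3 * 2 ^ L\<close> are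
  marked, and reduction modulo \<open>M\<close> is uniform up to a factor \<open>2\<close>.\<close>

lemma prob_hit_le:
  assumes x: "x \<in> patterns \<sigma> m" and L: "L = min_gram_length \<sigma> m" "1 \<le> L" and p: "p + L \<le> n"
  shows "measure_pmf.prob (random_text \<sigma> n) {t. hit \<sigma> x t p} \<le> 2 / real m ^ 2"
proof -
  have lx: "length x = m" using x by (simp add: patterns_def)
  define G where "G = gram_index \<sigma> x ` {..<D * 2 ^ L}"
  define N where "N = (\<sigma> + 1) ^ L"
  have map_eq: "map (\<lambda>j. encode \<sigma> (t ! (p + j))) [0..<L] = map (encode \<sigma>) (take L (drop p t))"
    if "length t = n" for t
  proof -
    have "length (take L (drop p t)) = L" using that p by simp
    then show ?thesis using that p by (intro nth_equalityI) simp_all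
  qed
  have "measure_pmf.prob (random_text \<sigma> n) {t. hit \<sigma> x t p} =
      measure_pmf.prob (random_text \<sigma> n) {t. radix_code (\<sigma> + 1) (map (encode \<sigma>) (take L (drop p t))) mod M \<in> G}"
  proof (rule measure_pmf.finite_measure_eq_AE)
    show "AE t in measure_pmf (random_text \<sigma> n). (t \<in> {t. hit \<sigma> x t p}) =
        (t \<in> {t. radix_code (\<sigma> + 1) (map (encode \<sigma>) (take L (drop p t))) mod M \<in> G})"
    proof (unfold AE_measure_pmf_iff set_pmf_random_text, intro ballI)
      fix t assume "t \<in> texts \<sigma> n"
      then have "length t = n" by (simp add: texts_def)
      from map_eq[OF this] show "(t \<in> {t. hit \<sigma> x t p}) =
          (t \<in> {t. radix_code (\<sigma> + 1) (map (encode \<sigma>) (take L (drop p t))) mod M \<in> G})"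
        by (simp only: hit_def lx G_def mem_Collect_eq)
    qed
  qed auto
  also have "\<dots> \<le> real (card G) * (real (N div M) + 1) / real (\<sigma> + 1) ^ L"
    unfolding N_def by (rule prob_code_mod_le[OF p]) (simp add: G_def)
  also have "\<dots> = real (card G) * (real (N div M) + 1) / real N" by (simp add: N_def)
  also have "\<dots> \<le> real (card G) * (2 * (real N / real M)) / real N"
  proof -
    \<comment> \<open>The defining property of the gram length: the codes fill the residues modulo
      \<open>M\<close> at least once, so \<open>N div M + 1\<close> is at most
      \<open>2 * N / M\<close>.\<close>
    have "M \<le> N" using min_gram_length_ge[OF \<sigma>, of m] L by (simp add: N_def)
    then have "1 \<le> real N / real M" using table_size_pos by simp
    moreover have "real (N div M) \<le> real N / real M" by (rule of_nat_div_le_of_nat)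
    ultimately show ?thesis by (intro divide_right_mono mult_left_mono) auto
  qed
  also have "\<dots> = 2 * real (card G) / real M" using \<sigma> by (simp add: N_def)
  also have "\<dots> \<le> 2 * (real m * 2 ^ L) / real M"
  proof -
    have "card G \<le> D * 2 ^ L" unfolding G_def using card_image_le[of "{..<D * 2 ^ L}"] by simp
    also have "\<dots> \<le> m * 2 ^ L" using L gram_length_le m by (intro mult_right_mono) auto
    finally have "real (card G) \<le> real (m * 2 ^ L)" by (rule of_nat_mono)
    then show ?thesis by (intro divide_right_mono mult_left_mono) auto
  qed
  also have "\<dots> = 2 / real m ^ 2" using m by (simp add: table_size_def L(1) field_simps power2_eq_square power3_eq_cube)
  finally show ?thesis .
qed

end

section \<open>Expected cost of a search\<close>

context word_size begin

text \<open>Since \<open>2 * L \<le> m\<close>, a round settles at least \<open>m / 2\<close>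
  starts.\<close>

lemma windows_count_le: "real windows_count \<le> 2 * real n / real m"
proof -
  have "windows_count = (n - m) div D + 1"
    unfolding windows_count_def by (rule div_add_self2) simp
  then have "real windows_count = real ((n - m) div D) + 1" by simp
  also have "real ((n - m) div D) \<le> real (n - m) / real D" by (rule of_nat_div_le_of_nat)
  also have "\<dots> \<le> real (n - m) / (real m / 2)"
    using gram_length_le m by (intro divide_left_mono) auto
  also have "\<dots> + 1 \<le> 2 * real n / real m" using m mn by (simp add: of_nat_diff field_simps)
  finally show ?thesis by simp
qed

text \<open>For a positive gram length the probability \<open>2 / m ^ 2\<close> cancels the cost
  \<open>17 * m ^ 2\<close>. For gram length \<open>0\<close> every round may hit, and the cost, at
  most \<open>34 * m ^ 2\<close>, is absorbed by \<open>B\<close>, which is available because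
  \<open>m\<close> is bounded in that case.\<close>

lemma verify_cost:
  assumes x: "x \<in> patterns \<sigma> m" and p: "p + L \<le> n" and m2: "2 \<le> m"
    and B: "1 \<le> B" "m < 2 * min_gram_length \<sigma> m \<Longrightarrow> real m ^ 2 \<le> B"
  shows "measure_pmf.prob (random_text \<sigma> n) {t. hit \<sigma> x t p} * real (D * (7 + 10 * m)) \<le> 34 * B"
proof (cases "m < 2 * min_gram_length \<sigma> m")
  case True
  then have "L = 0" by (simp add: gram_length_def)
  then have "D * (7 + 10 * m) \<le> (2 * m) * (17 * m)" using m by (intro mult_mono) auto
  then have "real (D * (7 + 10 * m)) \<le> real ((2 * m) * (17 * m))" by (rule of_nat_mono)
  then have "real (D * (7 + 10 * m)) \<le> 34 * B" using B(2)[OF True] by (simp add: power2_eq_square)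
  moreover have "measure_pmf.prob (random_text \<sigma> n) {t. hit \<sigma> x t p} * real (D * (7 + 10 * m))
      \<le> 1 * real (D * (7 + 10 * m))"
    by (intro mult_right_mono) auto
  ultimately show ?thesis by simp
next
  case False
  then have L: "L = min_gram_length \<sigma> m" by (simp add: gram_length_def)
  \<comment> \<open>Length \<open>0\<close> would mean \<open>m ^ 3 \<le> 1\<close>, which
    \<open>2 \<le> m\<close> excludes.\<close>
  have "min_gram_length \<sigma> m \<noteq> 0"
  proof
    assume "min_gram_length \<sigma> m = 0"
    then have "m ^ 3 \<le> 1" using min_gram_length_ge[OF \<sigma>, of m] by (simp add: table_size_def)
    moreover have "2 ^ 3 \<le> m ^ 3" using m2 by (rule power_mono) simp
    ultimately show False by simp
  qed
  then have L1: "1 \<le> L" using L by simp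
  have "D * (7 + 10 * m) \<le> m * (17 * m)" using L1 gram_length_le m by (intro mult_mono) auto
  then have "real (D * (7 + 10 * m)) \<le> real (m * (17 * m))" by (rule of_nat_mono)
  then have "real (D * (7 + 10 * m)) \<le> 17 * real m ^ 2" by (simp add: power2_eq_square)
  then have "measure_pmf.prob (random_text \<sigma> n) {t. hit \<sigma> x t p} * real (D * (7 + 10 * m))
      \<le> (2 / real m ^ 2) * (17 * real m ^ 2)"
    using prob_hit_le[OF x L L1 p] by (intro mult_mono) auto
  also have "\<dots> = 34" using m by simp
  finally show ?thesis using B(1) by linarith
qed

text \<open>Linearity of expectation over the rounds; no independence between rounds is
  involved.\<close>

lemma average_search_time_Wt:
  assumes m2: "2 \<le> m" and B: "1 \<le> B" "m < 2 * min_gram_length \<sigma> m \<Longrightarrow> real m ^ 2 \<le> B"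
  shows "average_search_time w Wt \<sigma> m n \<le> (real n / real m) * (46 + 68 * B + 16 * real (min_gram_length \<sigma> m))"
proof -
  let ?E = "measure_pmf.expectation (random_text \<sigma> n)"
  let ?cost = "real (D * (7 + 10 * m))"
  have "?E (\<lambda>t. real (search_time w Wt \<sigma> x t)) \<le> (real n / real m) * (46 + 68 * B + 16 * real (min_gram_length \<sigma> m))"
    if x: "x \<in> patterns \<sigma> m" for x
  proof -
    define H where "H j = {t. hit \<sigma> x t (j * D + m - L)}" for j
    define f where "f t = 16 + 4 * real (min_gram_length \<sigma> m) +
      (\<Sum>j<windows_count. 15 + 6 * real L + indicator (H j) t * ?cost)" for t
    have "?E (\<lambda>t. real (search_time w Wt \<sigma> x t)) \<le> ?E f"
    proof (rule integral_mono_AE)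
      show "AE t in measure_pmf (random_text \<sigma> n). real (search_time w Wt \<sigma> x t) \<le> f t"
        unfolding AE_measure_pmf_iff set_pmf_random_text
      proof
        fix t assume t: "t \<in> texts \<sigma> n"
        have "real (search_time w Wt \<sigma> x t) \<le> real (16 + 4 * min_gram_length \<sigma> m + (\<Sum>j<windows_count. 15 + 6 * L +
           (if hit \<sigma> x t (j * D + m - L) then D * (7 + 10 * m) else 0)))"
          using search_time_Wt[OF x t] by (rule of_nat_mono)
        also have "\<dots> = 16 + 4 * real (min_gram_length \<sigma> m) + (\<Sum>j<windows_count. real (15 + 6 * L +
           (if hit \<sigma> x t (j * D + m - L) then D * (7 + 10 * m) else 0)))"
          by (simp only: of_nat_add of_nat_sum of_nat_mult of_nat_numeral)
        also have "\<dots> = f t" unfolding f_def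
          by (intro arg_cong2[where f = plus] sum.cong refl) (auto simp: H_def indicator_def)
        finally show "real (search_time w Wt \<sigma> x t) \<le> f t" .
      qed
    qed simp_all
    also have "?E f = 16 + 4 * real (min_gram_length \<sigma> m) +
        (\<Sum>j<windows_count. 15 + 6 * real L + measure_pmf.prob (random_text \<sigma> n) (H j) * ?cost)"
      unfolding f_def by (subst Bochner_Integration.integral_add, simp, simp,
          subst Bochner_Integration.integral_sum, simp, simp)
    also have "\<dots> \<le> 16 + 4 * real (min_gram_length \<sigma> m) + (\<Sum>j<windows_count. 15 + 6 * real (min_gram_length \<sigma> m) + 34 * B)"
    proof (intro add_left_mono sum_mono add_mono)
      fix j assume "j \<in> {..<windows_count}"
      then have "j * D < n - m + 1" using windows_count_iff by blast
      then have "j * D \<le> n - m" by linarith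
      then have p: "j * D + m - L + L \<le> n" using mn gram_length_le by linarith
      show "measure_pmf.prob (random_text \<sigma> n) (H j) * ?cost \<le> 34 * B"
        unfolding H_def using x p m2 B by (rule verify_cost)
      have "L \<le> min_gram_length \<sigma> m" by (simp add: gram_length_def)
      then show "6 * real L \<le> 6 * real (min_gram_length \<sigma> m)" by simp
    qed
    also have "\<dots> = 16 + 4 * real (min_gram_length \<sigma> m) + real windows_count * (15 + 6 * real (min_gram_length \<sigma> m) + 34 * B)"
      by simp
    \<comment> \<open>The start-up cost is charged to \<open>n / m\<close>, which is at least
      \<open>1\<close>, and there are at most \<open>2 * n / m\<close> rounds. This yields
      \<open>46 = 16 + 2 * 15\<close>, \<open>68 = 2 * 34\<close> and
      \<open>16 = 4 + 2 * 6\<close>.\<close>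
    also have "\<dots> \<le> (real n / real m) * (16 + 4 * real (min_gram_length \<sigma> m))
        + (2 * real n / real m) * (15 + 6 * real (min_gram_length \<sigma> m) + 34 * B)"
    proof (rule add_mono)
      have "1 \<le> real n / real m" using m mn by simp
      then have "1 * (16 + 4 * real (min_gram_length \<sigma> m)) \<le> (real n / real m) * (16 + 4 * real (min_gram_length \<sigma> m))"
        by (rule mult_right_mono) simp
      then show "16 + 4 * real (min_gram_length \<sigma> m) \<le> (real n / real m) * (16 + 4 * real (min_gram_length \<sigma> m))" by simp
      show "real windows_count * (15 + 6 * real (min_gram_length \<sigma> m) + 34 * B)
        \<le> (2 * real n / real m) * (15 + 6 * real (min_gram_length \<sigma> m) + 34 * B)"
        by (rule mult_right_mono[OF windows_count_le]) (use B in simp)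
    qed
    also have "\<dots> = (real n / real m) * (46 + 68 * B + 16 * real (min_gram_length \<sigma> m))"
      by (simp add: algebra_simps)
    finally show ?thesis .
  qed
  moreover have "replicate m 0 \<in> patterns \<sigma> m" using \<sigma> by (auto simp: patterns_def)
  then have "patterns \<sigma> m \<noteq> {}" by blast
  ultimately show ?thesis unfolding average_search_time_def by (subst Max_le_iff) auto
qed

end

section \<open>Asymptotic estimates of the parameters\<close>

lemma min_gram_length_bounded:
  "\<exists>m0. \<forall>\<sigma> m. 2 \<le> \<sigma> \<longrightarrow> 1 \<le> m \<longrightarrow> m < 2 * min_gram_length \<sigma> m \<longrightarrow> m \<le> m0"
proof -
  have "eventually (\<lambda>m::nat. 4 * real m ^ 12 < 2 ^ m) at_top" by real_asymp
  then obtain m0 where m0: "\<And>m. m0 \<le> m \<Longrightarrow> 4 * real m ^ 12 < 2 ^ m"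
    unfolding eventually_at_top_linorder by blast
  show ?thesis
  proof (intro exI[of _ m0] allI impI)
    fix \<sigma> m :: nat assume a: "2 \<le> \<sigma>" "1 \<le> m" "m < 2 * min_gram_length \<sigma> m"
    \<comment> \<open>The naive case forces \<open>2 ^ m \<le> 4 * m ^ 12\<close>, which bounds
      \<open>m\<close> independently of \<open>\<sigma>\<close>.\<close>
    have "(2::nat) ^ m \<le> 2 ^ (2 * min_gram_length \<sigma> m)" using a(3) by (intro power_increasing) auto
    also have "\<dots> = (2 ^ min_gram_length \<sigma> m) ^ 2" by (simp add: power_mult[symmetric] mult.commute)
    also have "\<dots> \<le> (2 * m ^ 6) ^ 2" using two_power_min_gram_length[OF a(1,2)] by (rule power_mono) simp
    also have "\<dots> = 4 * m ^ 12" by (simp add: power_mult_distrib power_mult[symmetric])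
    finally have "real (2 ^ m) \<le> real (4 * m ^ 12)" by (rule of_nat_mono)
    then have "2 ^ m \<le> 4 * real m ^ 12" by simp
    then show "m \<le> m0" using m0[of m] by (meson linorder_not_less nat_le_linear order_less_le_trans less_irrefl)
  qed
qed

text \<open>The predecessor of the minimum still satisfies
  \<open>((\<sigma> + 1) / 2) ^ l \<le> m ^ 3\<close>; the summand \<open>1\<close> is the
  rounding.\<close>

lemma min_gram_length_le_log:
  assumes "2 \<le> \<sigma>" "1 \<le> m"
  shows "real (min_gram_length \<sigma> m) \<le> 3 * log (real (\<sigma> + 1) / 2) (real m) + 1"
proof (cases "min_gram_length \<sigma> m")
  case 0
  then show ?thesis using assms by simp
next
  case (Suc l)
  define b where "b = real (\<sigma> + 1) / 2"
  have b: "1 < b" using assms by (simp add: b_def)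
  have "(\<sigma> + 1) ^ l \<le> m ^ 3 * 2 ^ l" using min_gram_length_less[of l \<sigma> m] Suc by simp
  then have "real ((\<sigma> + 1) ^ l) \<le> real (m ^ 3 * 2 ^ l)" by (rule of_nat_mono)
  then have "b ^ l \<le> real m ^ 3" by (simp add: b_def power_divide field_simps)
  then have "log b (b ^ l) \<le> log b (real m ^ 3)" using b by (intro log_mono) auto
  then have "real l \<le> 3 * log b (real m)" using b assms by (simp add: log_nat_power)
  then show ?thesis using Suc by (simp add: b_def)
qed

text \<open>Split \<open>\<sigma> + 1\<close> into \<open>2\<close> and the base \<open>b\<close> of
  the logarithm; the power of \<open>b\<close> collapses to \<open>m ^ 3\<close>. The claimed space
  bound is thus \<open>m ^ 3 * 2 ^ l\<close> with \<open>l\<close> not rounded.\<close>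

lemma powr_log_eq:
  assumes "2 \<le> \<sigma>" "1 \<le> m"
  shows "real (\<sigma> + 1) powr (3 * log (real (\<sigma> + 1) / 2) (real m))
      = real m ^ 3 * 2 powr (3 * log (real (\<sigma> + 1) / 2) (real m))"
proof -
  define b where "b = real (\<sigma> + 1) / 2"
  have b: "1 < b" "real (\<sigma> + 1) = b * 2" using assms by (auto simp: b_def)
  have "b powr (3 * log b (real m)) = (b powr log b (real m)) powr 3"
    by (simp add: powr_powr mult.commute)
  also have "\<dots> = real m powr 3" using b(1) assms by simp
  also have "\<dots> = real m ^ 3" using assms powr_realpow[of "real m" 3] by simp
  finally show ?thesis unfolding b(2) using b(1) by (simp add: powr_mult)
qed

text \<open>Rounding up the gram length adds at most \<open>1\<close> to the exponent of
  \<open>2\<close> only, so it costs a factor \<open>2\<close> and not a factor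
  \<open>\<sigma> + 1\<close>.\<close>

lemma table_size_le_powr:
  assumes "2 \<le> \<sigma>" "1 \<le> m"
  shows "real (table_size \<sigma> m) \<le> 2 * real (\<sigma> + 1) powr (3 * log (real (\<sigma> + 1) / 2) (real m))"
proof -
  let ?l = "3 * log (real (\<sigma> + 1) / 2) (real m)"
  have "real (table_size \<sigma> m) = real m ^ 3 * 2 powr real (min_gram_length \<sigma> m)" by (simp add: table_size_def powr_realpow)
  also have "\<dots> \<le> real m ^ 3 * 2 powr (?l + 1)"
    using min_gram_length_le_log[OF assms] by (intro mult_left_mono powr_mono) auto
  also have "\<dots> = 2 * (real m ^ 3 * 2 powr ?l)" by (simp add: powr_add)
  finally show ?thesis by (simp only: powr_log_eq[OF assms])
qed

text \<open>Since \<open>\<sigma>\<close> is at most the square of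
  \<open>(\<sigma> + 1) / 2\<close>, the change of base costs at most a factor
  \<open>2\<close>.\<close>

lemma log_half_le:
  assumes "2 \<le> \<sigma>" "1 \<le> m"
  shows "log (real (\<sigma> + 1) / 2) (real m) \<le> 2 * log (real \<sigma>) (real m)"
proof -
  have "0 \<le> (real \<sigma> - 1) ^ 2" by simp
  then have "real \<sigma> \<le> (real (\<sigma> + 1) / 2) ^ 2" by (simp add: power2_eq_square field_simps)
  then have "ln (real \<sigma>) \<le> ln ((real (\<sigma> + 1) / 2) ^ 2)" using assms by simp
  also have "\<dots> = 2 * ln (real (\<sigma> + 1) / 2)" using assms by (simp add: ln_realpow)
  finally have "ln (real \<sigma>) \<le> 2 * ln (real (\<sigma> + 1) / 2)" .
  moreover have "0 < ln (real (\<sigma> + 1) / 2)" "0 < ln (real \<sigma>)" "0 \<le> ln (real m)" using assms by simp_all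
  ultimately have "ln (real m) / ln (real (\<sigma> + 1) / 2) \<le> ln (real m) / (ln (real \<sigma>) / 2)"
    by (intro divide_left_mono) auto
  then show ?thesis by (simp add: log_def mult.commute)
qed

lemma word_sizeI:
  assumes "2 \<le> \<sigma>" "1 \<le> m" "m < n" "20 * log 2 (real (n + \<sigma>)) \<le> real w"
  shows "word_size \<sigma> m n w"
proof
  have "real (n + \<sigma>) ^ 20 = 2 powr log 2 (real (n + \<sigma>) ^ 20)" using assms by simp
  also have "log 2 (real (n + \<sigma>) ^ 20) = 20 * log 2 (real (n + \<sigma>))" using assms by (simp add: log_nat_power)
  also have "2 powr (20 * log 2 (real (n + \<sigma>))) \<le> 2 powr real w" using assms(4) by (intro powr_mono) auto
  finally have "real ((n + \<sigma>) ^ 20) \<le> real (2 ^ w)" by (simp add: powr_realpow)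
  then show "(n + \<sigma>) ^ 20 \<le> 2 ^ w" by (simp only: of_nat_le_iff)
qed (use assms in auto)

text \<open>A search takes at least one unit of time, whereas the logarithm of \<open>m\<close> to
  base \<open>\<sigma>\<close> vanishes for \<open>m = 1\<close> and tends to \<open>0\<close> when
  \<open>\<sigma>\<close> outgrows all powers of \<open>m\<close>; hence \<open>2 \<le> m\<close>
  and \<open>\<sigma> \<le> m ^ C\<close> in the resource bounds. In the lower bound the slack
  \<open>\<epsilon> * m\<close> supplies the shifts on which robustness rests.\<close>

theorem theorem5:
  shows "(\<exists>(Wt :: algorithm) (K :: real).
            (\<forall>\<sigma> m n w :: nat.
               2 \<le> \<sigma> \<and> 1 \<le> m \<and> m < n \<and> K * log 2 (real (n + \<sigma>)) \<le> real w \<longrightarrow>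
               solves w Wt \<sigma> m n) \<and>
            (\<forall>C :: nat. \<exists>c :: real. \<forall>\<sigma> m n w :: nat.
               2 \<le> \<sigma> \<and> \<sigma> \<le> m ^ C \<and> 2 \<le> m \<and> m < n \<and>
               K * log 2 (real (n + \<sigma>)) \<le> real w \<longrightarrow>
               average_search_time w Wt \<sigma> m n
                 \<le> c * (real n * log (real \<sigma>) (real m) / real m) \<and>
               (\<forall>x \<in> patterns \<sigma> m.
                  real (preprocess_time w Wt \<sigma> x)
                    \<le> c * (real (\<sigma> + 1) powr (3 * log (real (\<sigma> + 1) / 2) (real m))
                           * real m * log (real \<sigma>) (real m)) \<and>
                  (\<forall>t \<in> texts \<sigma> n.
                     real (space_used w Wt \<sigma> x t)
                       \<le> c * real (\<sigma> + 1) powr (3 * log (real (\<sigma> + 1) / 2) (real m))))))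
       \<and> (\<forall>\<epsilon> :: real > 0. \<exists>c :: real > 0. \<forall>(A :: algorithm) (\<sigma> :: nat) (m :: nat) (n :: nat) (w :: nat).
            2 \<le> \<sigma> \<and> 1 \<le> m \<and> (1 + \<epsilon>) * real m \<le> real n \<and> solves w A \<sigma> m n \<longrightarrow>
            c * (real n * log (real \<sigma>) (real m) / real m) \<le> average_search_time w A \<sigma> m n)"
proof (intro conjI exI[of _ Wt] exI[of _ 20])
  show "\<forall>\<epsilon> :: real > 0. \<exists>c :: real > 0. \<forall>(A :: algorithm) (\<sigma> :: nat) (m :: nat) (n :: nat) (w :: nat).
            2 \<le> \<sigma> \<and> 1 \<le> m \<and> (1 + \<epsilon>) * real m \<le> real n \<and> solves w A \<sigma> m n \<longrightarrow>
            c * (real n * log (real \<sigma>) (real m) / real m) \<le> average_search_time w A \<sigma> m n"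
    using average_search_time_lower_bound by blast
  \<comment> \<open>The factor \<open>20\<close> is the exponent in the assumption of
    \<open>word_size\<close>.\<close>
  show "\<forall>\<sigma> m n w :: nat. 2 \<le> \<sigma> \<and> 1 \<le> m \<and> m < n \<and> 20 * log 2 (real (n + \<sigma>)) \<le> real w \<longrightarrow>
               solves w Wt \<sigma> m n"
    using word_size.solves_Wt[OF word_sizeI] by blast
  obtain m0 where m0: "\<And>\<sigma> m. 2 \<le> \<sigma> \<Longrightarrow> 1 \<le> m \<Longrightarrow> m < 2 * min_gram_length \<sigma> m \<Longrightarrow> m \<le> m0"
    using min_gram_length_bounded by blast
  \<comment> \<open>Bounds \<open>m ^ 2\<close>, and with it the cost of naive verification,
    whenever the gram length is set to \<open>0\<close>.\<close>
  define B where "B = max 1 (real m0 ^ 2)"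
  show "\<forall>C :: nat. \<exists>c :: real. \<forall>\<sigma> m n w :: nat.
               2 \<le> \<sigma> \<and> \<sigma> \<le> m ^ C \<and> 2 \<le> m \<and> m < n \<and>
               20 * log 2 (real (n + \<sigma>)) \<le> real w \<longrightarrow>
               average_search_time w Wt \<sigma> m n
                 \<le> c * (real n * log (real \<sigma>) (real m) / real m) \<and>
               (\<forall>x \<in> patterns \<sigma> m.
                  real (preprocess_time w Wt \<sigma> x)
                    \<le> c * (real (\<sigma> + 1) powr (3 * log (real (\<sigma> + 1) / 2) (real m))
                           * real m * log (real \<sigma>) (real m)) \<and>
                  (\<forall>t \<in> texts \<sigma> n.
                     real (space_used w Wt \<sigma> x t)
                       \<le> c * real (\<sigma> + 1) powr (3 * log (real (\<sigma> + 1) / 2) (real m))))"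
  proof
    fix C :: nat
    \<comment> \<open>The first two summands serve the search time, the third the preprocessing time
      and the last the space.\<close>
    define c where "c = (46 + 68 * B) * real C + 16 * (6 + real C) + 140 * real C + 4"
    have B1: "1 \<le> B" by (simp add: B_def)
    have c: "(46 + 68 * B) * real C + 16 * (6 + real C) \<le> c" "140 * real C \<le> c" "4 \<le> c" "0 \<le> c"
      using B1 by (auto simp: c_def)
    show "\<exists>c :: real. \<forall>\<sigma> m n w :: nat.
               2 \<le> \<sigma> \<and> \<sigma> \<le> m ^ C \<and> 2 \<le> m \<and> m < n \<and>
               20 * log 2 (real (n + \<sigma>)) \<le> real w \<longrightarrow>
               average_search_time w Wt \<sigma> m n
                 \<le> c * (real n * log (real \<sigma>) (real m) / real m) \<and>
               (\<forall>x \<in> patterns \<sigma> m.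
                  real (preprocess_time w Wt \<sigma> x)
                    \<le> c * (real (\<sigma> + 1) powr (3 * log (real (\<sigma> + 1) / 2) (real m))
                           * real m * log (real \<sigma>) (real m)) \<and>
                  (\<forall>t \<in> texts \<sigma> n.
                     real (space_used w Wt \<sigma> x t)
                       \<le> c * real (\<sigma> + 1) powr (3 * log (real (\<sigma> + 1) / 2) (real m))))"
    proof (intro exI[of _ c] allI impI, elim conjE)
      fix \<sigma> m n w :: nat
      assume \<sigma>: "2 \<le> \<sigma>" and \<sigma>m: "\<sigma> \<le> m ^ C" and m2: "2 \<le> m" and mn: "m < n"
        and w: "20 * log 2 (real (n + \<sigma>)) \<le> real w"
      from m2 have m1: "1 \<le> m" by simp
      interpret word_size \<sigma> m n w by (rule word_sizeI[OF \<sigma> m1 mn w])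
      define lg where "lg = log (real \<sigma>) (real m)"
      define P where "P = real (\<sigma> + 1) powr (3 * log (real (\<sigma> + 1) / 2) (real m))"
      have P: "0 \<le> P" "real M \<le> 2 * P" using table_size_le_powr[OF \<sigma> m1] by (auto simp: P_def)
      \<comment> \<open>From \<open>\<sigma> \<le> m ^ C\<close> follows
        \<open>1 \<le> C * lg\<close>, which turns additive constants into multiples of
        \<open>lg\<close>.\<close>
      have "1 = log (real \<sigma>) (real \<sigma>)" using \<sigma> by simp
      also have "\<dots> \<le> log (real \<sigma>) (real (m ^ C))"
        using \<sigma> \<sigma>m by (intro log_mono) (auto simp del: of_nat_power)
      also have "\<dots> = real C * lg" using m by (simp add: lg_def log_nat_power)
      finally have C: "1 \<le> real C * lg" .
      have lg0: "0 \<le> lg" using \<sigma> m by (simp add: lg_def)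
      have len: "real (min_gram_length \<sigma> m) \<le> (6 + real C) * lg"
        using min_gram_length_le_log[OF \<sigma> m1] log_half_le[OF \<sigma> m1] C by (simp add: lg_def[symmetric] algebra_simps)
      have avg: "average_search_time w Wt \<sigma> m n \<le> c * (real n * lg / real m)"
      proof -
        have "real m ^ 2 \<le> B" if "m < 2 * min_gram_length \<sigma> m"
        proof -
          have "real m ^ 2 \<le> real m0 ^ 2" using m0[OF \<sigma> m1 that] by (intro power_mono) auto
          then show ?thesis by (simp add: B_def le_max_iff_disj)
        qed
        then have "average_search_time w Wt \<sigma> m n
            \<le> (real n / real m) * (46 + 68 * B + 16 * real (min_gram_length \<sigma> m))"
          by (rule average_search_time_Wt[OF m2 B1])
        also have "\<dots> \<le> (real n / real m) * (c * lg)"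
        proof (rule mult_left_mono)
          have "(46 + 68 * B) * 1 \<le> (46 + 68 * B) * (real C * lg)"
            using B1 by (intro mult_left_mono C) simp
          then have "46 + 68 * B + 16 * real (min_gram_length \<sigma> m)
              \<le> ((46 + 68 * B) * real C + 16 * (6 + real C)) * lg"
            using len by (simp add: algebra_simps)
          also have "\<dots> \<le> c * lg" by (rule mult_right_mono[OF c(1) lg0])
          finally show "46 + 68 * B + 16 * real (min_gram_length \<sigma> m) \<le> c * lg" .
        qed simp
        finally show ?thesis by (simp add: mult_ac)
      qed
      have pre: "real (preprocess_time w Wt \<sigma> x) \<le> c * (P * real m * lg)" if "x \<in> patterns \<sigma> m" for x
      proof -
        have "real (preprocess_time w Wt \<sigma> x) \<le> real (70 * M)"
          using preprocess_time_Wt[OF that] by (rule of_nat_mono)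
        also have "\<dots> \<le> 140 * P * 1 * 1" using P by simp
        also have "\<dots> \<le> 140 * P * real m * (real C * lg)"
          using P(1) m C by (intro mult_mono) auto
        also have "\<dots> = (140 * real C) * (P * real m * lg)" by simp
        also have "\<dots> \<le> c * (P * real m * lg)" using P(1) lg0 by (intro mult_right_mono c(2)) auto
        finally show ?thesis .
      qed
      have space: "real (space_used w Wt \<sigma> x t) \<le> c * P"
        if "x \<in> patterns \<sigma> m" "t \<in> texts \<sigma> n" for x t
      proof -
        have "real (space_used w Wt \<sigma> x t) \<le> real (2 * M)"
          using space_used_Wt[OF that] by (rule of_nat_mono)
        also have "\<dots> \<le> 4 * P" using P by simp
        also have "\<dots> \<le> c * P" by (rule mult_right_mono[OF c(3) P(1)])
        finally show ?thesis .
      qed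
      show "average_search_time w Wt \<sigma> m n \<le> c * (real n * log (real \<sigma>) (real m) / real m) \<and>
               (\<forall>x \<in> patterns \<sigma> m.
                  real (preprocess_time w Wt \<sigma> x)
                    \<le> c * (real (\<sigma> + 1) powr (3 * log (real (\<sigma> + 1) / 2) (real m))
                           * real m * log (real \<sigma>) (real m)) \<and>
                  (\<forall>t \<in> texts \<sigma> n.
                     real (space_used w Wt \<sigma> x t)
                       \<le> c * real (\<sigma> + 1) powr (3 * log (real (\<sigma> + 1) / 2) (real m))))"
        using avg pre space unfolding P_def lg_def by blast
    qed
  qed
qed

end
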